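(* Let $k\ge 1$ be an integer, let $c\in\mathbb{C}\setminus\{0\}$, and let $R(z)$, $Q(z)$ be non-zero polynomials. If the delay-differential equation $$f^2(z)+R^2(z)\bigl(f^{(k)}(z+c)-f^{(k)}(z)\bigr)^2=Q(z)$$ has a transcendental entire solution $f$ of finite order, then $f$ takes the form $$f(z)=\frac{Q_1(z)e^{az+b}+Q_2(z)e^{-(az+b)}}{2},$$ where $a,b\in\mathbb{C}$ and $Q_1(z),Q_2(z)$ are polynomials such that $Q_1(z)Q_2(z)=Q(z)$. Moreover, one of the following conclusions holds: (i) If $e^{ac}\neq 1$, then $k$ must be odd, and $Q(z)$ and $R(z)$ reduce to constants, with $R(z)\equiv R$ satisfying $2iRa^k+1=0$. (ii) If $e^{ac}=1$, then $\deg R(z)=1$, neither $Q_1(z)$ nor $Q_2(z)$ is constant, and $$R(z)=\frac{Q_1(z)}{i\sum_{l=0}^{k}\binom{k}{l}a^{k-l}\left[Q_1^{(l)}(z+c)-Q_1^{(l)}(z)\right]}=\frac{Q_2(z)}{i\sum_{l=0}^{k}\binom{k}{l}(-1)^{k-l+1}a^{k-l}\left[Q_2^{(l)}(z+c)-Q_2^{(l)}(z)\right]}.$$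
   Context: The order of a meromorphic function $f$ on $\mathbb{C}$ is $\rho(f)=\limsup_{r\to\infty}\frac{\log T(r,f)}{\log r}$, where $T(r,f)$ is the Nevanlinna characteristic; finite order means $\rho(f)<\infty$. $g^{(l)}$ denotes the $l$-th derivative of $g$, with $g^{(0)}=g$, and $g^{(l)}(z+c)$ is that derivative evaluated at $z+c$. *)

theory Defs
  imports
    "HOL-Complex_Analysis.Complex_Analysis"
    "HOL-Computational_Algebra.Computational_Algebra"
begin

text \<open>
  Nevanlinna's functions, for \<open>f\<close> meromorphic on the complex plane. As usual for meromorphic
  functions in Isabelle/HOL, \<open>f\<close> is a total function whose values at its poles are irrelevant.
\<close>

text \<open>
  \<open>log\<^sup>+ x = max 0 (log x)\<close> for \<open>x > 0\<close>, and \<open>log\<^sup>+ 0 = 0\<close> because \<open>ln 0 = 0\<close>.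
\<close>
definition log_plus :: "real \<Rightarrow> real" where
  "log_plus x = max 0 (ln x)"

definition proximity :: "real \<Rightarrow> (complex \<Rightarrow> complex) \<Rightarrow> real" where
  "proximity r f =
     1 / (2 * pi) * integral {0..2 * pi} (\<lambda>\<theta>. log_plus (cmod (f (of_real r * cis \<theta>))))"

text \<open>
  The number of poles in the closed disc of radius \<open>r\<close>, counted with multiplicity. The order of a
  pole \<open>z\<close> is \<open>- zorder f z\<close>.
\<close>
definition pole_count :: "real \<Rightarrow> (complex \<Rightarrow> complex) \<Rightarrow> nat" where
  "pole_count r f = (\<Sum>z\<in>{z \<in> cball 0 r. is_pole f z}. nat (- zorder f z))"

definition pole_counting :: "real \<Rightarrow> (complex \<Rightarrow> complex) \<Rightarrow> real" where
  "pole_counting r f =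
     integral {0..r} (\<lambda>t. (real (pole_count t f) - real (pole_count 0 f)) / t)
       + real (pole_count 0 f) * ln r"

definition nevanlinna_char :: "real \<Rightarrow> (complex \<Rightarrow> complex) \<Rightarrow> real" where
  "nevanlinna_char r f = proximity r f + pole_counting r f"

text \<open>
  The convention \<open>ln 0 = 0\<close> only plays a role when the characteristic vanishes for arbitrarily
  large \<open>r\<close>, which does not happen for nonconstant \<open>f\<close>.
\<close>
definition growth_order :: "(complex \<Rightarrow> complex) \<Rightarrow> ereal" where
  "growth_order f = Limsup at_top (\<lambda>r. ereal (ln (nevanlinna_char r f) / ln r))"

definition finite_order :: "(complex \<Rightarrow> complex) \<Rightarrow> bool" where
  "finite_order f \<longleftrightarrow> growth_order f < \<infinity>"

definition transcendental_entire :: "(complex \<Rightarrow> complex) \<Rightarrow> bool" where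
  "transcendental_entire f \<longleftrightarrow>
     f holomorphic_on UNIV \<and> \<not> (\<exists>p :: complex poly. \<forall>z. f z = poly p z)"

text \<open>
  Equality \<open>R = P / D\<close> of rational functions, for a polynomial function \<open>D\<close>: the denominator
  is not identically zero, and the values agree wherever it does not vanish.
\<close>
definition eq_quotient :: "complex poly \<Rightarrow> complex poly \<Rightarrow> (complex \<Rightarrow> complex) \<Rightarrow> bool" where
  "eq_quotient R P D \<longleftrightarrow>
     (\<exists>z. D z \<noteq> 0) \<and> (\<forall>z. D z \<noteq> 0 \<longrightarrow> poly R z = poly P z / D z)"

end

theory Submission
  imports Defs
begin

text \<open>
  Put \<open>g(z) = R(z) (f\<^sup>(\<^sup>k\<^sup>)(z + c) - f\<^sup>(\<^sup>k\<^sup>)(z))\<close>. The equation reads \<open>(f + ig)(f - ig) = Q\<close>, so the two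
  factors have only finitely many zeros. If \<open>f\<close> has finite order, then so have \<open>g\<close> and both
  factors; hence \<open>f + ig = Q\<^sub>1 e\<^sup>p\<close> and \<open>f - ig = Q\<^sub>2 e\<^sup>-\<^sup>p\<close> for polynomials with \<open>Q\<^sub>1 Q\<^sub>2 = Q\<close>
  (lemma \<open>solution_form\<close>), and \<open>f\<close> is half the sum of the two.

  The analytic part lies in passing from the Nevanlinna characteristic to a pointwise bound
  \<open>|f(z)| \<le> exp (C (1 + |z|)\<^sup>n)\<close>. For entire \<open>f\<close> the characteristic is the mean of \<open>log\<^sup>+ |f|\<close> over
  a circle. By the Weierstrass theorem, \<open>log\<^sup>+ |f|\<close> is approximated on that circle from above by the
  real part of a polynomial \<open>P\<close>; the maximum principle for \<open>f e\<^sup>-\<^sup>P\<close> and the Harnack inequality for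
  \<open>Re P > 0\<close>, which follows from the Schwarz lemma, then give
  \<open>log |f(z)| \<le> 3 m(2r, f)\<close> for \<open>|z| \<le> r\<close> (lemma \<open>cmod_le_exp_proximity\<close>). This replaces the
  Poisson-Jensen formula. The class of functions with such a bound is closed under all operations
  needed to form \<open>g\<close>, and its zero-free entire members are exponentials of polynomials, by the same
  Harnack inequality in the role of the Borel-Caratheodory theorem.

  Substituting back, with \<open>f\<^sup>(\<^sup>k\<^sup>) = (A e\<^sup>p + B e\<^sup>-\<^sup>p) / 2\<close>, gives a linear relation with polynomial
  coefficients between \<open>e\<^sup>\<plusminus>\<^sup>p\<^sup>(\<^sup>z\<^sup>)\<close> and \<open>e\<^sup>\<plusminus>\<^sup>p\<^sup>(\<^sup>z\<^sup>+\<^sup>c\<^sup>)\<close>. Exponentials of polynomials that pairwise differ by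
  nonconstant polynomials are linearly independent over the polynomials (lemma
  \<open>exp_poly_independent\<close>). If \<open>deg p \<ge> 2\<close> the four exponentials are independent, which forces
  \<open>A = 0\<close> and then \<open>Q\<^sub>1 = 0\<close>; and \<open>deg p = 0\<close> would make \<open>f\<close> a polynomial. So \<open>p(z) = az + b\<close>, and
  with \<open>w = e\<^sup>a\<^sup>c\<close> the relation splits into \<open>i R(z) (w A(z + c) - A(z)) = Q\<^sub>1(z)\<close> and its counterpart
  for \<open>B\<close>, \<open>Q\<^sub>2\<close>, \<open>1/w\<close>. Comparing the two highest coefficients yields both alternatives: for
  \<open>w \<noteq> 1\<close> the degree does not drop, so \<open>R\<close> is constant, the leading coefficients give \<open>w = (-1)\<^sup>k\<close>, and
  a nonconstant \<open>Q\<^sub>1\<close> or \<open>Q\<^sub>2\<close> would make \<open>ac\<close> real, contradicting \<open>w = -1\<close>; for \<open>w = 1\<close> the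
  degree drops by exactly one, so \<open>deg R = 1\<close>.
\<close>

section \<open>Harnack's inequality and approximation on circles\<close>

text \<open>
  A Harnack inequality, obtained by applying the Schwarz lemma to the Cayley transform of \<open>g\<close>.
\<close>
lemma cmod_le_of_Re_pos:
  fixes g :: "complex \<Rightarrow> complex"
  assumes hol: "g holomorphic_on ball 0 \<rho>" and "\<rho> > 0"
    and pos: "\<And>z. cmod z < \<rho> \<Longrightarrow> Re (g z) > 0"
    and z: "cmod z \<le> \<rho> / 2"
  shows "cmod (g z - \<i> * Im (g 0)) \<le> 3 * Re (g 0)"
proof -
  define a where "a = Re (g 0)"
  have "a > 0" using pos[of 0] \<open>\<rho> > 0\<close> by (simp add: a_def)
  define F where "F = (\<lambda>w. g (of_real \<rho> * w) - \<i> * Im (g 0))"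
  define \<phi> where "\<phi> = (\<lambda>w. (F w - of_real a) / (F w + of_real a))"
  have scale: "cmod (of_real \<rho> * w) < \<rho>" if "cmod w < 1" for w
    using that \<open>\<rho> > 0\<close> by (simp add: norm_mult)
  have RePos: "Re (F w) > 0" if "cmod w < 1" for w
    using pos[OF scale[OF that]] by (simp add: F_def)
  have ne: "F w + of_real a \<noteq> 0" if "cmod w < 1" for w
    using RePos[OF that] \<open>a > 0\<close> by (auto simp: complex_eq_iff)
  have "(g \<circ> (\<lambda>w. of_real \<rho> * w)) holomorphic_on ball 0 1"
    by (rule holomorphic_on_compose_gen[OF _ hol]) (use scale in \<open>auto intro!: holomorphic_intros\<close>)
  then have "F holomorphic_on ball 0 1"
    unfolding F_def o_def by (intro holomorphic_intros)
  then have hol\<phi>: "\<phi> holomorphic_on ball 0 1"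
    unfolding \<phi>_def by (intro holomorphic_intros) (use ne in auto)
  have F0: "F 0 = of_real a" by (simp add: F_def a_def complex_eq_iff)
  have lt1: "cmod (\<phi> w) < 1" if "cmod w < 1" for w
  proof -
    have "(cmod (F w - of_real a))\<^sup>2 < (cmod (F w + of_real a))\<^sup>2"
      using mult_pos_pos[OF RePos[OF that] \<open>a > 0\<close>]
      unfolding cmod_power2 by (simp add: power2_eq_square algebra_simps)
    then have "cmod (F w - of_real a) < cmod (F w + of_real a)"
      by (simp add: power2_less_imp_less)
    then show ?thesis using ne[OF that] by (simp add: \<phi>_def norm_divide)
  qed
  define w where "w = z / of_real \<rho>"
  have w: "cmod w \<le> 1 / 2" using z \<open>\<rho> > 0\<close> by (simp add: w_def norm_divide field_simps)
  have "cmod (\<phi> w) \<le> cmod w"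
    using Schwarz_Lemma(1)[OF hol\<phi> _ lt1] w F0 by (simp add: \<phi>_def)
  then have "cmod (F w - of_real a) \<le> cmod w * cmod (F w + of_real a)"
    using w ne[of w] by (simp add: \<phi>_def norm_divide field_simps)
  also have "\<dots> \<le> 1 / 2 * cmod (F w + of_real a)"
    by (intro mult_right_mono w) simp
  finally have "cmod (F w - of_real a) \<le> 1 / 2 * cmod (F w + of_real a)" .
  moreover have "cmod (F w + of_real a) \<le> cmod (F w) + a"
    using norm_triangle_ineq[of "F w" "of_real a"] \<open>a > 0\<close> by simp
  moreover have "cmod (F w) \<le> cmod (F w - of_real a) + a"
    using norm_triangle_ineq[of "F w - of_real a" "of_real a"] \<open>a > 0\<close> by simp
  ultimately have "cmod (F w) \<le> 3 * a" by simp
  then show ?thesis using \<open>\<rho> > 0\<close> by (simp add: F_def w_def a_def)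
qed

text \<open>
  On the circle of radius \<open>\<rho>\<close>, \<open>cnj z = \<rho>\<^sup>2 / z\<close>; this lowers the degrees of \<open>P\<close> and \<open>Q\<close>
  simultaneously.
\<close>
lemma Re_poly_mult_cnj_on_circle:
  fixes P Q :: "complex poly"
  shows "\<exists>S. \<forall>z. cmod z = \<rho> \<longrightarrow> Re (poly P z * cnj (poly Q z)) = Re (poly S z)"
proof (induction P arbitrary: Q)
  case 0
  show ?case by (rule exI[of _ 0]) simp
next
  case (pCons a P)
  obtain b Q' where Q: "Q = pCons b Q'" by (rule pCons_cases)
  obtain S where S: "\<And>z. cmod z = \<rho> \<Longrightarrow> Re (poly P z * cnj (poly Q' z)) = Re (poly S z)"
    using pCons.IH[of Q'] by blast
  let ?S = "smult (cnj a) Q + smult (cnj b) (pCons 0 P) + smult (of_real (\<rho>\<^sup>2)) S"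
  have "Re (poly (pCons a P) z * cnj (poly Q z)) = Re (poly ?S z)" if "cmod z = \<rho>" for z
  proof -
    have zz: "z * cnj z = of_real (\<rho>\<^sup>2)"
      using that complex_norm_square[of z] by simp
    have "poly (pCons a P) z * cnj (poly Q z)
        = a * cnj (poly Q z) + cnj b * (z * poly P z) + (z * cnj z) * (poly P z * cnj (poly Q' z))"
      by (simp add: Q algebra_simps)
    also have "Re \<dots> = Re (a * cnj (poly Q z)) + Re (cnj b * (z * poly P z))
        + \<rho>\<^sup>2 * Re (poly P z * cnj (poly Q' z))"
      unfolding zz by simp
    also have "Re (a * cnj (poly Q z)) = Re (cnj a * poly Q z)"
      by simp
    also have "Re (poly P z * cnj (poly Q' z)) = Re (poly S z)"
      by (rule S[OF that])
    finally have "Re (poly (pCons a P) z * cnj (poly Q z)) = Re (cnj a * poly Q z)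
        + Re (cnj b * (z * poly P z)) + \<rho>\<^sup>2 * Re (poly S z)" .
    moreover have "poly ?S z = cnj a * poly Q z + cnj b * (z * poly P z) + of_real (\<rho>\<^sup>2) * poly S z"
      by simp
    moreover have "Re (of_real (\<rho>\<^sup>2) * poly S z) = \<rho>\<^sup>2 * Re (poly S z)" by simp
    ultimately show ?thesis by (simp only: plus_complex.sel)
  qed
  then show ?case by blast
qed

lemma real_polynomial_on_circle:
  fixes u :: "complex \<Rightarrow> real"
  assumes "real_polynomial_function u"
  shows "\<exists>P. \<forall>z. cmod z = \<rho> \<longrightarrow> u z = Re (poly P z)"
  using assms
proof induction
  case (linear f)
  interpret bounded_linear f by fact
  have "f z = Re (poly [:0, Complex (f 1) (- f \<i>):] z)" for z
  proof -
    have "f z = f (Re z *\<^sub>R 1 + Im z *\<^sub>R \<i>)"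
      by (rule arg_cong[of _ _ f]) (simp add: complex_eq_iff)
    also have "\<dots> = Re z * f 1 + Im z * f \<i>" by (simp only: add scaleR real_scaleR_def)
    finally show ?thesis by simp
  qed
  then show ?case by blast
next
  case (const c)
  show ?case by (rule exI[of _ "[:of_real c:]"]) simp
next
  case (add f g)
  then obtain P Q where "\<forall>z. cmod z = \<rho> \<longrightarrow> f z = Re (poly P z)" "\<forall>z. cmod z = \<rho> \<longrightarrow> g z = Re (poly Q z)"
    by blast
  then show ?case by (intro exI[of _ "P + Q"]) simp
next
  case (mult f g)
  then obtain P Q where PQ: "\<forall>z. cmod z = \<rho> \<longrightarrow> f z = Re (poly P z)" "\<forall>z. cmod z = \<rho> \<longrightarrow> g z = Re (poly Q z)"
    by blast
  obtain S where S: "\<And>z. cmod z = \<rho> \<Longrightarrow> Re (poly P z * cnj (poly Q z)) = Re (poly S z)"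
    using Re_poly_mult_cnj_on_circle[of \<rho> P Q] by blast
  (* Re x * Re y is the mean of Re (x * y) and Re (x * cnj y). *)
  have "f z * g z = Re (poly (smult (1/2) (P * Q + S)) z)" if "cmod z = \<rho>" for z
    using S[OF that] PQ that by (simp add: field_simps)
  then show ?case by blast
qed

lemma continuous_Re_poly_approx_on_circle:
  fixes u :: "complex \<Rightarrow> real"
  assumes "continuous_on (sphere 0 \<rho>) u" "\<epsilon> > 0"
  obtains P where "\<And>z. cmod z = \<rho> \<Longrightarrow> \<bar>u z - Re (poly P z)\<bar> < \<epsilon>"
proof -
  obtain v where v: "real_polynomial_function v" "\<And>z. z \<in> sphere 0 \<rho> \<Longrightarrow> \<bar>u z - v z\<bar> < \<epsilon>"
    using Stone_Weierstrass_real_polynomial_function[of "sphere 0 \<rho>" u \<epsilon>] assms by auto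
  obtain P where "\<forall>z. cmod z = \<rho> \<longrightarrow> v z = Re (poly P z)"
    using real_polynomial_on_circle[OF v(1)] by blast
  then show ?thesis using v(2) that[of P] by auto
qed

section \<open>From the proximity function to a pointwise bound\<close>

lemma log_plus_nonneg [simp]: "log_plus x \<ge> 0"
  by (simp add: log_plus_def)

lemma log_plus_eq_ln_max: "x \<ge> 0 \<Longrightarrow> log_plus x = ln (max 1 x)"
  by (cases "x = 0") (auto simp: log_plus_def max_def)

lemma le_exp_log_plus: "x \<ge> 0 \<Longrightarrow> x \<le> exp (log_plus x)"
  by (simp add: log_plus_eq_ln_max)

lemma continuous_on_log_plus_cmod:
  assumes "continuous_on S f"
  shows "continuous_on S (\<lambda>z. log_plus (cmod (f z)))"
proof -
  have "continuous_on S (\<lambda>z. ln (max 1 (cmod (f z))))"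
    using assms by (intro continuous_intros) auto
  then show ?thesis by (simp add: log_plus_eq_ln_max)
qed

lemma holomorphic_mean_value:
  fixes g :: "complex \<Rightarrow> complex"
  assumes "g holomorphic_on UNIV" "\<rho> > 0"
  shows "((\<lambda>\<theta>. g (of_real \<rho> * cis \<theta>)) has_integral 2 * pi * g 0) {0..2 * pi}"
proof -
  have "((\<lambda>u. g u / (u - 0) ^ Suc 0) has_contour_integral 2 * pi * \<i> / fact 0 * (deriv ^^ 0) g 0) (circlepath 0 \<rho>)"
    using assms by (intro Cauchy_has_contour_integral_higher_derivative_circlepath)
     (auto intro: holomorphic_on_subset holomorphic_on_imp_continuous_on)
  then have "((\<lambda>u. g u / u) has_contour_integral 2 * pi * \<i> * g 0) (part_circlepath 0 \<rho> 0 (2 * pi))"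
    by (simp add: circlepath_def)
  then have "((\<lambda>t. g (of_real \<rho> * cis t) / (of_real \<rho> * cis t) * \<rho> * \<i> * cis t) has_integral 2 * pi * \<i> * g 0) {0..2*pi}"
    by (subst (asm) has_contour_integral_part_circlepath_iff) auto
  then have "((\<lambda>t. \<i> * g (of_real \<rho> * cis t)) has_integral 2 * pi * \<i> * g 0) {0..2*pi}"
    using assms(2) by (simp add: field_simps)
  from has_integral_mult_right[OF this, of "-\<i>"]
  have "((\<lambda>t. - \<i> * (\<i> * g (of_real \<rho> * cis t))) has_integral - \<i> * (2 * pi * \<i> * g 0)) {0..2*pi}" .
  moreover have "- \<i> * (\<i> * w) = w" for w by (simp flip: mult.assoc)
  moreover have "- \<i> * (2 * pi * \<i> * g 0) = 2 * pi * g 0" by (simp add: complex_eq_iff)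
  ultimately show ?thesis by (simp only:)
qed

text \<open>
  The polynomial \<open>P\<close> in the proof has a positive real part on the circle of radius \<open>2r\<close> that exceeds
  \<open>log\<^sup>+ |f|\<close> by at most \<open>3\<epsilon>\<close>; it serves as the harmonic majorant of \<open>log |f|\<close>. The factor \<open>3\<close> is
  the Harnack constant for the concentric disc of half the radius.
\<close>
lemma cmod_le_exp_proximity:
  assumes hol: "f holomorphic_on UNIV" and "r > 0" and z: "cmod z \<le> r"
  shows "cmod (f z) \<le> exp (3 * proximity (2 * r) f)"
proof (cases "f z = 0")
  case False
  have contf: "continuous_on A f" for A
    using hol holomorphic_on_imp_continuous_on holomorphic_on_subset by blast
  have "ln (cmod (f z)) \<le> 3 * proximity (2 * r) f + e" if "e > 0" for e
  proof -
    define \<epsilon> where "\<epsilon> = e / 9"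
    have "\<epsilon> > 0" using that by (simp add: \<epsilon>_def)
    define u where "u = (\<lambda>z. log_plus (cmod (f z)))"
    have contu: "continuous_on A u" for A
      unfolding u_def by (intro continuous_on_log_plus_cmod contf)
    have "continuous_on (sphere 0 (2 * r)) (\<lambda>z. u z + 2 * \<epsilon>)"
      by (intro continuous_intros contu)
    then obtain P where P: "\<And>z. cmod z = 2 * r \<Longrightarrow> \<bar>u z + 2 * \<epsilon> - Re (poly P z)\<bar> < \<epsilon>"
      using continuous_Re_poly_approx_on_circle \<open>\<epsilon> > 0\<close> by blast
    have lo: "u w + \<epsilon> < Re (poly P w)" and hi: "Re (poly P w) < u w + 3 * \<epsilon>" if "cmod w = 2 * r" for w
      using P[OF that] by (auto simp: abs_less_iff)
    have maxmod: "cmod (g w) \<le> B" 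
      if "g holomorphic_on UNIV" "\<And>w. cmod w = 2 * r \<Longrightarrow> cmod (g w) \<le> B" "cmod w \<le> 2 * r" for g w B
      using that \<open>r > 0\<close>
      by (intro maximum_modulus_frontier[of g "cball 0 (2 * r)" B w])
       (auto intro: holomorphic_on_subset holomorphic_on_imp_continuous_on)
    (* Minimum principle for Re P, as the maximum principle for exp (- P). *)
    have "Re (poly P w) \<ge> \<epsilon>" if "cmod w \<le> 2 * r" for w
    proof -
      have "cmod (exp (- poly P w)) \<le> exp (- \<epsilon>)"
      proof (rule maxmod[OF _ _ that])
        show "cmod (exp (- poly P v)) \<le> exp (- \<epsilon>)" if "cmod v = 2 * r" for v
        proof -
          have "\<epsilon> \<le> Re (poly P v)"
            using lo[OF that] log_plus_nonneg[of "cmod (f v)"] unfolding u_def by linarith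
          then show ?thesis by (simp add: norm_exp_eq_Re)
        qed
      qed (intro holomorphic_intros)
      then show ?thesis by simp
    qed
    then have pos: "Re (poly P w) > 0" if "cmod w < 2 * r" for w
      using that \<open>\<epsilon> > 0\<close> by (meson less_eq_real_def order_less_le_trans)
    have le1: "cmod (f v * exp (- poly P v)) \<le> 1" if "cmod v = 2 * r" for v
    proof -
      have "cmod (f v) \<le> exp (u v)" unfolding u_def by (rule le_exp_log_plus) simp
      also have "\<dots> \<le> exp (Re (poly P v))" using lo[OF that] \<open>\<epsilon> > 0\<close> by simp
      finally show ?thesis by (simp add: norm_mult norm_divide exp_minus field_simps)
    qed
    have "cmod (f z * exp (- poly P z)) \<le> 1"
      by (rule maxmod[of "\<lambda>z. f z * exp (- poly P z)", OF _ le1])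
        (use hol z \<open>r > 0\<close> in \<open>auto intro!: holomorphic_on_mult holomorphic_intros\<close>)
    then have "cmod (f z) \<le> exp (Re (poly P z))"
      by (simp add: norm_mult norm_divide exp_minus field_simps)
    then have "ln (cmod (f z)) \<le> Re (poly P z)"
      using False by (metis ln_exp ln_le_cancel_iff exp_gt_zero zero_less_norm_iff)
    also have "Re (poly P z) = Re (poly P z - \<i> * Im (poly P 0))" by simp
    also have "\<dots> \<le> cmod (poly P z - \<i> * Im (poly P 0))" by (rule complex_Re_le_cmod)
    also have "\<dots> \<le> 3 * Re (poly P 0)"
      using pos z \<open>r > 0\<close>
      by (intro cmod_le_of_Re_pos[where \<rho> = "2 * r"]) (auto intro!: holomorphic_intros)
    also have "Re (poly P 0) \<le> proximity (2 * r) f + 3 * \<epsilon>"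
    proof -
      have *: "((\<lambda>\<theta>. poly P (of_real (2 * r) * cis \<theta>)) has_integral 2 * pi * poly P 0) {0..2 * pi}"
        using \<open>r > 0\<close> by (intro holomorphic_mean_value holomorphic_intros) auto
      have "((\<lambda>\<theta>. Re (poly P (of_real (2 * r) * cis \<theta>))) has_integral Re (2 * pi * poly P 0)) {0..2 * pi}"
        using has_integral_linear[OF * bounded_linear_Re] by (simp add: o_def)
      moreover have "((\<lambda>\<theta>. u (of_real (2 * r) * cis \<theta>) + 3 * \<epsilon>) has_integral 
          (integral {0..2 * pi} (\<lambda>\<theta>. u (of_real (2 * r) * cis \<theta>)) + (3 * \<epsilon>) * (2 * pi))) {0..2 * pi}"
      proof (intro has_integral_add integrable_integral integrable_continuous_interval)
        show "continuous_on {0..2 * pi} (\<lambda>\<theta>. u (of_real (2 * r) * cis \<theta>))"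
          by (intro continuous_on_compose2[OF contu[of UNIV]] continuous_intros) auto
        show "((\<lambda>x. 3 * \<epsilon>) has_integral 3 * \<epsilon> * (2 * pi)) {0..2 * pi}"
          using has_integral_const_real[of "3 * \<epsilon>" 0 "2 * pi"] by (simp add: mult.commute)
      qed
      ultimately have "Re (2 * pi * poly P 0) \<le> 
          integral {0..2 * pi} (\<lambda>\<theta>. u (of_real (2 * r) * cis \<theta>)) + (3 * \<epsilon>) * (2 * pi)"
      proof (rule has_integral_le)
        show "Re (poly P (of_real (2 * r) * cis \<theta>)) \<le> u (of_real (2 * r) * cis \<theta>) + 3 * \<epsilon>" for \<theta>
          using \<open>r > 0\<close> by (intro less_imp_le hi) (simp add: norm_mult)
      qed
      then show ?thesis by (simp add: proximity_def u_def field_simps)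
    qed
    finally show ?thesis by (simp add: \<epsilon>_def)
  qed
  then have "ln (cmod (f z)) \<le> 3 * proximity (2 * r) f"
    by (rule field_le_epsilon)
  then show ?thesis using False by (metis exp_le_cancel_iff exp_ln zero_less_norm_iff)
qed simp

section \<open>Entire functions of finite order\<close>

lemma nevanlinna_char_entire:
  assumes "f holomorphic_on UNIV"
  shows "nevanlinna_char r f = proximity r f"
proof -
  have "\<not> is_pole f z" for z
    using not_is_pole_holomorphic[OF open_UNIV _ assms] by simp
  then have "pole_count t f = 0" for t by (simp add: pole_count_def)
  then show ?thesis by (simp add: nevanlinna_char_def pole_counting_def)
qed

text \<open>
  Growth of at most \<open>exp (C (1 + |z|)\<^sup>n)\<close> in the whole plane; for entire functions this is finiteness
  of the order. The summand \<open>1\<close> makes the bound usable near the origin as well.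
\<close>
definition poly_exp_bounded :: "(complex \<Rightarrow> complex) \<Rightarrow> bool" where
  "poly_exp_bounded f \<longleftrightarrow> (\<exists>C n. \<forall>z. cmod (f z) \<le> exp (C * (1 + cmod z) ^ n))"

lemma poly_exp_boundedE:
  assumes "poly_exp_bounded f"
  obtains C n where "C \<ge> 0" "\<And>z. cmod (f z) \<le> exp (C * (1 + cmod z) ^ n)"
proof -
  obtain C n where C: "\<And>z. cmod (f z) \<le> exp (C * (1 + cmod z) ^ n)"
    using assms unfolding poly_exp_bounded_def by blast
  have "cmod (f z) \<le> exp (max C 0 * (1 + cmod z) ^ n)" for z
  proof -
    note C[of z]
    also have "exp (C * (1 + cmod z) ^ n) \<le> exp (max C 0 * (1 + cmod z) ^ n)"
      unfolding exp_le_cancel_iff by (intro mult_right_mono) auto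
    finally show ?thesis .
  qed
  then show ?thesis using that[of "max C 0" n] by auto
qed

lemma poly_exp_boundedI:
  assumes "\<And>z. cmod (f z) \<le> exp (A * (1 + cmod z) ^ m + B * (1 + cmod z) ^ n)" "A \<ge> 0" "B \<ge> 0"
  shows "poly_exp_bounded f"
  unfolding poly_exp_bounded_def
proof (intro exI allI)
  fix z
  have "A * (1 + cmod z) ^ m + B * (1 + cmod z) ^ n
      \<le> A * (1 + cmod z) ^ (m + n) + B * (1 + cmod z) ^ (m + n)"
    by (intro add_mono mult_left_mono power_increasing assms) auto
  then show "cmod (f z) \<le> exp ((A + B) * (1 + cmod z) ^ (m + n))"
    by (intro order_trans[OF assms(1)]) (simp add: algebra_simps)
qed

lemma poly_exp_bounded_const: "poly_exp_bounded (\<lambda>z. c)"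
proof (rule poly_exp_boundedI[where A = "cmod c" and m = 0 and B = 0])
  have "cmod c \<le> exp (cmod c)" using exp_ge_add_one_self[of "cmod c"] by linarith
  then show "cmod c \<le> exp (cmod c * (1 + cmod z) ^ 0 + 0 * (1 + cmod z) ^ n)" for z n by simp
qed auto

lemma poly_exp_bounded_ident: "poly_exp_bounded (\<lambda>z. z)"
proof (rule poly_exp_boundedI[where A = 1 and m = 1 and B = 0])
  have "cmod z \<le> exp (1 + cmod z)" for z using exp_ge_add_one_self[of "1 + cmod z"] by linarith
  then show "cmod z \<le> exp (1 * (1 + cmod z) ^ 1 + 0 * (1 + cmod z) ^ n)" for z n by simp
qed auto

lemma poly_exp_bounded_mult:
  assumes "poly_exp_bounded f" "poly_exp_bounded g"
  shows "poly_exp_bounded (\<lambda>z. f z * g z)"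
proof -
  obtain A m where A: "A \<ge> 0" "\<And>z. cmod (f z) \<le> exp (A * (1 + cmod z) ^ m)"
    using poly_exp_boundedE[OF assms(1)] by blast
  obtain B n where B: "B \<ge> 0" "\<And>z. cmod (g z) \<le> exp (B * (1 + cmod z) ^ n)"
    using poly_exp_boundedE[OF assms(2)] by blast
  show ?thesis
    using A B by (intro poly_exp_boundedI[where A = A and B = B and m = m and n = n])
     (auto simp: norm_mult exp_add intro!: mult_mono)
qed

lemma poly_exp_bounded_add:
  assumes "poly_exp_bounded f" "poly_exp_bounded g"
  shows "poly_exp_bounded (\<lambda>z. f z + g z)"
proof -
  obtain A m where A: "A \<ge> 0" "\<And>z. cmod (f z) \<le> exp (A * (1 + cmod z) ^ m)"
    using poly_exp_boundedE[OF assms(1)] by blast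
  obtain B n where B: "B \<ge> 0" "\<And>z. cmod (g z) \<le> exp (B * (1 + cmod z) ^ n)"
    using poly_exp_boundedE[OF assms(2)] by blast
  show ?thesis
  proof (rule poly_exp_boundedI)
    fix z
    define a b where "a = A * (1 + cmod z) ^ m" and "b = B * (1 + cmod z) ^ n"
    have ab: "a \<ge> 0" "b \<ge> 0" using A(1) B(1) by (auto simp: a_def b_def)
    have one: "1 \<le> (1 + cmod z) ^ m" by (intro one_le_power) auto
    have "cmod (f z + g z) \<le> exp a + exp b"
      using A(2)[of z] B(2)[of z] norm_triangle_ineq[of "f z" "g z"] by (simp add: a_def b_def)
    also have "\<dots> \<le> 2 * exp (a + b)"
    proof -
      have "exp a \<le> exp (a + b)" "exp b \<le> exp (a + b)" using ab by auto
      then show ?thesis by linarith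
    qed
    also have "\<dots> \<le> exp 1 * exp (a + b)"
      using exp_ge_add_one_self[of 1] by (intro mult_right_mono) auto
    also have "\<dots> = exp (1 + a + b)" by (simp add: exp_add)
    also have "\<dots> \<le> exp ((1 + A) * (1 + cmod z) ^ m + B * (1 + cmod z) ^ n)"
      using one by (simp add: a_def b_def algebra_simps)
    finally show "cmod (f z + g z) \<le> \<dots>" .
  qed (use A B in auto)
qed

lemma poly_exp_bounded_poly: "poly_exp_bounded (poly p)"
proof (induction p)
  case 0
  show ?case using poly_exp_bounded_const[of 0] by (simp add: fun_eq_iff poly_exp_bounded_def)
next
  case (pCons a p)
  have "poly_exp_bounded (\<lambda>z. a + z * poly p z)"
    by (intro poly_exp_bounded_add poly_exp_bounded_mult poly_exp_bounded_const
        poly_exp_bounded_ident pCons.IH)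
  then show ?case by (simp add: poly_exp_bounded_def)
qed

lemma poly_exp_bounded_shift:
  assumes "poly_exp_bounded f"
  shows "poly_exp_bounded (\<lambda>z. f (z + c))"
proof -
  obtain A m where A: "A \<ge> 0" "\<And>z. cmod (f z) \<le> exp (A * (1 + cmod z) ^ m)"
    using poly_exp_boundedE[OF assms] by blast
  show ?thesis
  proof (rule poly_exp_boundedI[where A = "A * (1 + cmod c) ^ m" and m = m and B = 0])
    fix z and n :: nat
    have "1 + cmod (z + c) \<le> (1 + cmod c) * (1 + cmod z)"
    proof -
      have "0 \<le> cmod c * cmod z" by simp
      moreover have "(1 + cmod c) * (1 + cmod z) = 1 + cmod c + cmod z + cmod c * cmod z"
        by (simp add: algebra_simps)
      ultimately show ?thesis using norm_triangle_ineq[of z c] by linarith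
    qed
    then have "A * (1 + cmod (z + c)) ^ m \<le> A * ((1 + cmod c) * (1 + cmod z)) ^ m"
      using A(1) by (intro mult_left_mono power_mono) auto
    then show "cmod (f (z + c)) \<le> exp (A * (1 + cmod c) ^ m * (1 + cmod z) ^ m + 0 * (1 + cmod z) ^ n)"
      by (intro order_trans[OF A(2)]) (simp add: power_mult_distrib mult.assoc)
  qed (use A in auto)
qed

lemma poly_exp_bounded_higher_deriv:
  assumes bd: "poly_exp_bounded f" and hol: "f holomorphic_on UNIV"
  shows "poly_exp_bounded ((deriv ^^ k) f)"
proof -
  obtain A m where A: "A \<ge> 0" "\<And>z. cmod (f z) \<le> exp (A * (1 + cmod z) ^ m)"
    using poly_exp_boundedE[OF bd] by blast
  show ?thesis
  proof (rule poly_exp_boundedI[where A = "A * 2 ^ m" and m = m and B = "fact k" and n = 0])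
    fix z
    have "cmod ((deriv ^^ k) f z) \<le> fact k * exp (A * 2 ^ m * (1 + cmod z) ^ m) / 1 ^ k"
    proof (rule Cauchy_inequality)
      fix w assume "cmod (z - w) = 1"
      then have "1 + cmod w \<le> 2 * (1 + cmod z)"
        using norm_triangle_ineq2[of w z] norm_ge_zero[of z] norm_minus_commute[of z w]
        unfolding distrib_left by linarith
      then have "A * (1 + cmod w) ^ m \<le> A * (2 * (1 + cmod z)) ^ m"
        using A(1) by (intro mult_left_mono power_mono) auto
      then show "cmod (f w) \<le> exp (A * 2 ^ m * (1 + cmod z) ^ m)"
        by (intro order_trans[OF A(2)]) (simp only: exp_le_cancel_iff power_mult_distrib mult.assoc)
    qed (use hol in \<open>auto intro: holomorphic_on_subset holomorphic_on_imp_continuous_on\<close>)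
    also have "\<dots> \<le> exp (fact k) * exp (A * 2 ^ m * (1 + cmod z) ^ m)"
    proof -
      have "(fact k :: real) \<le> exp (fact k)" using exp_ge_add_one_self[of "fact k"] by linarith
      then show ?thesis by simp
    qed
    finally show "cmod ((deriv ^^ k) f z) \<le> exp (A * 2 ^ m * (1 + cmod z) ^ m + fact k * (1 + cmod z) ^ 0)"
      by (simp add: exp_add mult.commute)
  qed (use A in auto)
qed

text \<open>
  The values of \<open>ln\<close> at \<open>0\<close> do not matter: where the characteristic is not positive, the bound
  \<open>T(r, f) \<le> r\<^sup>N\<close> is trivial.
\<close>
lemma finite_order_imp_poly_exp_bounded:
  assumes hol: "f holomorphic_on UNIV" and "finite_order f"
  shows "poly_exp_bounded f"
proof -
  have "growth_order f < \<infinity>" using assms(2) by (simp add: finite_order_def)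
  then obtain N :: nat where "growth_order f < ereal (real N)"
    using less_PInf_Ex_of_nat[of "growth_order f"] by auto
  then have "eventually (\<lambda>r. ereal (ln (nevanlinna_char r f) / ln r) < ereal (real N)) at_top"
    unfolding growth_order_def by (rule Limsup_lessD)
  then obtain R where R: "\<And>r. r \<ge> R \<Longrightarrow> ln (nevanlinna_char r f) / ln r < real N"
    unfolding eventually_at_top_linorder by auto
  define S where "S = max R 1"
  have prox: "proximity r f \<le> r ^ N" if "r > S" for r
  proof (cases "proximity r f > 0")
    case True
    have "r > 1" "r \<ge> R" using that by (auto simp: S_def)
    have "ln (proximity r f) / ln r < real N"
      using R[OF \<open>r \<ge> R\<close>] nevanlinna_char_entire[OF hol] by simp
    then have "ln (proximity r f) < ln (r ^ N)"
      using \<open>r > 1\<close> by (simp add: field_simps ln_realpow)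
    then show ?thesis using True \<open>r > 1\<close> by simp
  next
    case False
    moreover have "r ^ N \<ge> 0" using that by (auto simp: S_def)
    ultimately show ?thesis by linarith
  qed
  show ?thesis unfolding poly_exp_bounded_def
  proof (intro exI allI)
    fix z
    define r where "r = S + cmod z"
    have "S \<ge> 1" by (simp add: S_def)
    then have "r > 0" "cmod z \<le> r" "2 * r > S" by (auto simp: r_def add_pos_nonneg)
    have "2 * r \<le> 2 * S * (1 + cmod z)"
      using \<open>S \<ge> 1\<close> mult_right_mono[of 1 S "cmod z"] by (simp add: r_def algebra_simps)
    then have "(2 * r) ^ N \<le> (2 * S * (1 + cmod z)) ^ N"
      using \<open>r > 0\<close> by (intro power_mono) auto
    then have "proximity (2 * r) f \<le> (2 * S) ^ N * (1 + cmod z) ^ N"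
      using prox[OF \<open>2 * r > S\<close>] unfolding power_mult_distrib by linarith
    moreover have "cmod (f z) \<le> exp (3 * proximity (2 * r) f)"
      by (rule cmod_le_exp_proximity) fact+
    ultimately show "cmod (f z) \<le> exp (3 * (2 * S) ^ N * (1 + cmod z) ^ N)"
      by (elim order_trans) (simp add: mult.assoc)
  qed
qed

section \<open>Factors of a polynomial\<close>

lemma poly_exp_bounded_divide_root:
  assumes hol: "F holomorphic_on UNIV" and bd: "poly_exp_bounded F" and "F w = 0"
  obtains F1 where "F1 holomorphic_on UNIV" "poly_exp_bounded F1" "\<And>z. F z = (z - w) * F1 z"
proof -
  define F1 where "F1 = (\<lambda>z. if z = w then deriv F w else F z / (z - w))"
  have eq: "F z = (z - w) * F1 z" for z using \<open>F w = 0\<close> by (simp add: F1_def)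
  have hol1: "F1 holomorphic_on UNIV"
    by (rule pole_theorem_open_0[OF hol open_UNIV, of w]) (use eq \<open>F w = 0\<close> in \<open>auto simp: F1_def\<close>)
  have "compact (F1 ` cball w 1)"
    using hol1 by (intro compact_continuous_image)
      (auto intro: holomorphic_on_subset holomorphic_on_imp_continuous_on)
  then obtain B where B: "\<And>z. z \<in> cball w 1 \<Longrightarrow> cmod (F1 z) \<le> B"
    using compact_imp_bounded bounded_iff by (metis imageI)
  have "B \<ge> 0" using B[of w] by (meson centre_in_cball norm_ge_zero order_trans zero_le_one)
  obtain A m where A: "A \<ge> 0" "\<And>z. cmod (F z) \<le> exp (A * (1 + cmod z) ^ m)"
    using poly_exp_boundedE[OF bd] by blast
  have "poly_exp_bounded F1"
  proof (rule poly_exp_boundedI[where A = A and m = m and B = B and n = 0])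
    fix z
    let ?e = "A * (1 + cmod z) ^ m"
    have "?e \<ge> 0" using A(1) by simp
    show "cmod (F1 z) \<le> exp (?e + B * (1 + cmod z) ^ 0)"
    proof (cases "z \<in> cball w 1")
      case True
      have "cmod (F1 z) \<le> B" by (rule B[OF True])
      also have "\<dots> \<le> exp B" using exp_ge_add_one_self[of B] by linarith
      also have "\<dots> \<le> exp (?e + B * (1 + cmod z) ^ 0)" using \<open>?e \<ge> 0\<close> by simp
      finally show ?thesis .
    next
      case False
      then have "1 \<le> cmod (z - w)" by (simp add: dist_norm norm_minus_commute)
      then have "cmod (F1 z) \<le> cmod (z - w) * cmod (F1 z)"
        using mult_right_mono[of 1 "cmod (z - w)" "cmod (F1 z)"] by simp
      also have "\<dots> = cmod (F z)" by (simp add: eq norm_mult)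
      also have "\<dots> \<le> exp ?e" by (rule A)
      also have "\<dots> \<le> exp (?e + B * (1 + cmod z) ^ 0)" using \<open>B \<ge> 0\<close> by simp
      finally show ?thesis .
    qed
  qed (use A \<open>B \<ge> 0\<close> in auto)
  then show ?thesis using that hol1 eq by blast
qed

lemma continuous_eq_off_point:
  fixes u v :: "complex \<Rightarrow> complex"
  assumes "continuous_on UNIV u" "continuous_on UNIV v" "\<And>z. z \<noteq> w \<Longrightarrow> u z = v z"
  shows "u z = v z"
proof (cases "z = w")
  case True
  have "u \<midarrow>w\<rightarrow> u w" "v \<midarrow>w\<rightarrow> v w"
    using assms(1,2) by (simp_all add: continuous_on_eq_continuous_at isCont_def)
  moreover have "u \<midarrow>w\<rightarrow> v w" 
    using calculation(2) by (rule Lim_transform_eventually) (use assms(3) in \<open>auto simp: eventually_at_filter\<close>)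
  ultimately show ?thesis using True by (metis LIM_unique)
qed (use assms(3) in auto)

text \<open>
  Induction on the degree of \<open>Q\<close>: a root of \<open>Q\<close> is a zero of \<open>F\<close> or of \<open>G\<close> and is divided out
  there. Carrying the growth bound along the induction avoids having to estimate \<open>F / Q\<^sub>1\<close>.
\<close>
lemma entire_factors_of_poly:
  fixes Q :: "complex poly"
  assumes "F holomorphic_on UNIV" "G holomorphic_on UNIV" "poly_exp_bounded F" "Q \<noteq> 0"
    and "\<And>z. F z * G z = poly Q z"
  shows "\<exists>Q1 Q2 E1 E2. Q1 * Q2 = Q \<and> E1 holomorphic_on UNIV \<and> poly_exp_bounded E1
    \<and> (\<forall>z. F z = poly Q1 z * E1 z \<and> G z = poly Q2 z * E2 z \<and> E1 z * E2 z = 1)"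
  using assms
proof (induction "degree Q" arbitrary: Q F G)
  case 0
  then obtain q where q: "Q = [:q:]" by (metis degree_eq_zeroE)
  with 0 have "q \<noteq> 0" by simp
  then show ?case using 0 q
    by (intro exI[of _ 1] exI[of _ Q] exI[of _ F] exI[of _ "\<lambda>z. G z / q"]) auto
next
  case (Suc d)
  have "\<not> constant (poly Q)" using Suc.hyps(2) by (simp add: constant_degree)
  then obtain w where "poly Q w = 0" using fundamental_theorem_of_algebra by blast
  then obtain Q' where Q': "Q = [:- w, 1:] * Q'" by (auto simp: poly_eq_0_iff_dvd)
  with Suc.prems have "Q' \<noteq> 0" by auto
  then have deg: "d = degree Q'" using Suc.hyps(2) by (simp add: Q' degree_mult_eq del: mult_pCons_left)
  have pQ: "poly Q z = (z - w) * poly Q' z" for z by (simp add: Q' algebra_simps)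
  have cont: "h holomorphic_on UNIV \<Longrightarrow> continuous_on UNIV h" for h :: "complex \<Rightarrow> complex"
    by (rule holomorphic_on_imp_continuous_on)
  consider "F w = 0" | "G w = 0"
    using Suc.prems(5)[of w] \<open>poly Q w = 0\<close> by auto
  then show ?case
  proof cases
    case 1
    obtain F1 where F1: "F1 holomorphic_on UNIV" "poly_exp_bounded F1" "\<And>z. F z = (z - w) * F1 z"
      using poly_exp_bounded_divide_root[OF Suc.prems(1,3) 1] by blast
    have "F1 z * G z = poly Q' z" for z
    proof (rule continuous_eq_off_point[where u = "\<lambda>z. F1 z * G z" and w = w])
      show "continuous_on UNIV (\<lambda>z. F1 z * G z)"
        by (intro continuous_on_mult cont F1 Suc.prems)
      show "F1 z * G z = poly Q' z" if "z \<noteq> w" for z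
        using Suc.prems(5)[of z] that by (simp add: F1(3) pQ mult.assoc)
    qed (intro continuous_intros)
    then obtain Q1 Q2 E1 E2 where *: "Q1 * Q2 = Q'" "E1 holomorphic_on UNIV" "poly_exp_bounded E1"
      "\<And>z. F1 z = poly Q1 z * E1 z \<and> G z = poly Q2 z * E2 z \<and> E1 z * E2 z = 1"
      using Suc.hyps(1)[OF deg F1(1) Suc.prems(2) F1(2) \<open>Q' \<noteq> 0\<close>] by blast
    have "poly ([:- w, 1:] * Q1) z = (z - w) * poly Q1 z" for z by (simp add: algebra_simps)
    moreover have "([:- w, 1:] * Q1) * Q2 = Q" unfolding Q' *(1)[symmetric] by (rule mult.assoc)
    ultimately show ?thesis
      using * F1(3) by (intro exI[of _ "[:- w, 1:] * Q1"] exI[of _ Q2] exI[of _ E1] exI[of _ E2])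
        (simp only: mult.assoc, simp)
  next
    case 2
    define G1 where "G1 = (\<lambda>z. if z = w then deriv G w else G z / (z - w))"
    have eq: "G z = (z - w) * G1 z" for z using 2 by (simp add: G1_def)
    have hol1: "G1 holomorphic_on UNIV"
      by (rule pole_theorem_open_0[OF Suc.prems(2) open_UNIV, of w]) (use eq 2 in \<open>auto simp: G1_def\<close>)
    have "F z * G1 z = poly Q' z" for z
    proof (rule continuous_eq_off_point[where u = "\<lambda>z. F z * G1 z" and w = w])
      show "continuous_on UNIV (\<lambda>z. F z * G1 z)"
        by (intro continuous_on_mult cont hol1 Suc.prems)
      show "F z * G1 z = poly Q' z" if "z \<noteq> w" for z
        using Suc.prems(5)[of z] that by (simp add: eq pQ mult.left_commute)
    qed (intro continuous_intros)
    then obtain Q1 Q2 E1 E2 where *: "Q1 * Q2 = Q'" "E1 holomorphic_on UNIV" "poly_exp_bounded E1"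
      "\<And>z. F z = poly Q1 z * E1 z \<and> G1 z = poly Q2 z * E2 z \<and> E1 z * E2 z = 1"
      using Suc.hyps(1)[OF deg Suc.prems(1) hol1 Suc.prems(3) \<open>Q' \<noteq> 0\<close>] by blast
    have "poly ([:- w, 1:] * Q2) z = (z - w) * poly Q2 z" for z by (simp add: algebra_simps)
    moreover have "Q1 * ([:- w, 1:] * Q2) = Q" unfolding Q' *(1)[symmetric] by (rule mult.left_commute)
    ultimately show ?thesis
      using * eq by (intro exI[of _ Q1] exI[of _ "[:- w, 1:] * Q2"] exI[of _ E1] exI[of _ E2])
        (simp only: mult.assoc, simp)
  qed
qed

text \<open>
  The logarithm \<open>h\<close> of \<open>E\<close> has \<open>Re h \<le> A (1 + |z|)\<^sup>m\<close>. Harnack's inequality for \<open>M - h\<close> turns this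
  into a polynomial bound of \<open>|h|\<close>, and Liouville's theorem applies.
\<close>
lemma zero_free_poly_exp_bounded:
  assumes hol: "E holomorphic_on UNIV" and bd: "poly_exp_bounded E" and nz: "\<And>z. E z \<noteq> 0"
  obtains p where "\<And>z. E z = exp (poly p z)"
proof -
  obtain h where h: "h holomorphic_on UNIV" "\<And>z. E z = exp (h z)"
    using contractible_imp_holomorphic_log[OF hol contractible_UNIV] nz by (metis UNIV_I)
  obtain A m where A: "A \<ge> 0" "\<And>z. cmod (E z) \<le> exp (A * (1 + cmod z) ^ m)"
    using poly_exp_boundedE[OF bd] by blast
  have Reh: "Re (h z) \<le> A * (1 + cmod z) ^ m" for z
    using A(2)[of z] by (simp add: h(2))
  define K where "K = 4 * (A * 4 ^ m + 1) + 3 * cmod (h 0) + cmod (h 0)"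
  have "cmod (h z) \<le> K * cmod z ^ m" if z: "1 \<le> cmod z" for z
  proof -
    define M where "M = A * (1 + 2 * cmod z) ^ m + 1"
    have "M \<ge> 0" using A(1) by (simp add: M_def)
    have pos: "Re (M - h w) > 0" if "cmod w < 2 * cmod z" for w
    proof -
      have "A * (1 + cmod w) ^ m \<le> A * (1 + 2 * cmod z) ^ m"
        using that A(1) by (intro mult_left_mono power_mono) auto
      then show ?thesis using Reh[of w] by (simp add: M_def)
    qed
    have "cmod (M - h z - \<i> * Im (M - h 0)) \<le> 3 * Re (M - h 0)"
      using pos z by (intro cmod_le_of_Re_pos[where \<rho> = "2 * cmod z"])
        (auto intro!: holomorphic_intros holomorphic_on_subset[OF h(1)])
    moreover have "cmod (h z) \<le> cmod (of_real M) + cmod (M - h z - \<i> * Im (M - h 0)) + cmod (\<i> * Im (h 0))"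
    proof -
      have eq: "h z = of_real M - (M - h z - \<i> * Im (M - h 0)) + \<i> * Im (h 0)" by simp
      have tri: "cmod (x - y + w) \<le> cmod x + cmod y + cmod w" for x y w
        using norm_triangle_ineq[of "x - y" w] norm_triangle_ineq4[of x y] by linarith
      show ?thesis
        by (subst (1) eq) (rule tri)
    qed
    ultimately have "cmod (h z) \<le> M + 3 * (M - Re (h 0)) + \<bar>Im (h 0)\<bar>"
      using \<open>M \<ge> 0\<close> by (simp add: norm_mult)
    also have "\<dots> \<le> 4 * M + 3 * cmod (h 0) + cmod (h 0)"
    proof -
      have "- Re (h 0) \<le> cmod (h 0)" using abs_Re_le_cmod[of "h 0"] by linarith
      then show ?thesis using abs_Im_le_cmod[of "h 0"] unfolding right_diff_distrib by linarith
    qed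
    also have "\<dots> \<le> K * cmod z ^ m"
    proof -
      have one: "1 \<le> cmod z ^ m" using z by (intro one_le_power) auto
      have "(1 + 2 * cmod z) ^ m \<le> (4 * cmod z) ^ m" using z by (intro power_mono) auto
      then have "A * (1 + 2 * cmod z) ^ m \<le> A * (4 ^ m * cmod z ^ m)"
        using A(1) by (intro mult_left_mono) (auto simp: power_mult_distrib)
      moreover have "cmod (h 0) \<le> cmod (h 0) * cmod z ^ m"
        using mult_left_mono[OF one, of "cmod (h 0)"] by simp
      ultimately show ?thesis using one unfolding M_def K_def
        by (simp add: algebra_simps)
    qed
    finally show ?thesis .
  qed
  then have "h z = (\<Sum>k\<le>m. (deriv ^^ k) h 0 / fact k * z ^ k)" for z
    using Liouville_polynomial[OF h(1), of 1 K m] by blast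
  then have "h z = poly (\<Sum>k\<le>m. monom ((deriv ^^ k) h 0 / fact k) k) z" for z
    by (simp add: poly_sum poly_monom)
  with h(2) have "E z = exp (poly (\<Sum>k\<le>m. monom ((deriv ^^ k) h 0 / fact k) k) z)" for z
    by simp
  then show ?thesis by (rule that)
qed

section \<open>Linear independence of exponentials of polynomials\<close>

text \<open>
  The operator induced on coefficients by differentiation:
  \<open>(P e\<^sup>q)' = (P' + q' P) e\<^sup>q\<close>.
\<close>
definition exp_deriv :: "complex poly \<Rightarrow> complex poly \<Rightarrow> complex poly" where
  "exp_deriv q P = pderiv P + pderiv q * P"

lemma has_field_derivative_poly_mult_exp_poly:
  "((\<lambda>z. poly P z * exp (poly q z)) has_field_derivative poly (exp_deriv q P) z * exp (poly q z)) (at z)"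
  by (auto intro!: derivative_eq_intros simp: exp_deriv_def algebra_simps)

lemma exp_deriv_nonzero:
  assumes "degree q \<noteq> 0" "P \<noteq> 0"
  shows "exp_deriv q P \<noteq> 0"
proof
  assume "exp_deriv q P = 0"
  then have eq: "pderiv P = - (pderiv q * P)" by (simp add: exp_deriv_def eq_neg_iff_add_eq_0)
  have "pderiv q \<noteq> 0" using assms by (simp add: pderiv_eq_0_iff)
  then have nz: "pderiv q * P \<noteq> 0" using assms by simp
  then have "degree P \<noteq> 0" using eq pderiv_eq_0_iff[of P] by auto
  moreover have "degree (pderiv P) = degree (pderiv q) + degree P"
    using \<open>pderiv q \<noteq> 0\<close> assms by (simp add: eq degree_mult_eq)
  ultimately show False by (simp add: degree_pderiv)
qed

lemma funpow_exp_deriv_eq_0D: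
  assumes "degree q \<noteq> 0" "(exp_deriv q ^^ k) P = 0"
  shows "P = 0"
  using assms(2) by (induction k) (use exp_deriv_nonzero[OF assms(1)] in auto)

lemma funpow_pderiv_eq_0:
  fixes P :: "complex poly"
  assumes "degree P < k"
  shows "(pderiv ^^ k) P = 0"
  using assms by (intro poly_eqI) (simp add: coeff_higher_pderiv coeff_eq_0)

lemma degree_double:
  fixes x :: "complex poly"
  shows "degree (x + x) = degree x" "degree (- x - x) = degree x"
proof -
  have *: "x + x = smult 2 x" by (metis one_add_one smult_add_left smult_1_left)
  show "degree (x + x) = degree x" unfolding * by simp
  have "- x - x = - (x + x)" by simp
  then show "degree (- x - x) = degree x" unfolding * by simp
qed

text \<open>
  Borel's theorem in the polynomial case. After division by one of the exponentials, repeated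
  differentiation kills its polynomial coefficient and replaces each other coefficient by an
  iterate of \<open>exp_deriv\<close>, which does not vanish unless the coefficient did.
\<close>
lemma exp_poly_independent:
  fixes P q :: "'i \<Rightarrow> complex poly"
  assumes "finite I"
    and "\<And>i j. i \<in> I \<Longrightarrow> j \<in> I \<Longrightarrow> i \<noteq> j \<Longrightarrow> degree (q i - q j) \<noteq> 0"
    and "\<And>z. (\<Sum>i\<in>I. poly (P i) z * exp (poly (q i) z)) = 0"
    and "i \<in> I"
  shows "P i = 0"
  using assms
proof (induction I arbitrary: P q i rule: finite_induct)
  case (insert j I)
  define r where "r = (\<lambda>i. q i - q j)"
  have "(\<Sum>i\<in>I. poly ((exp_deriv (r i) ^^ k) (P i)) z * exp (poly (r i) z)) = - poly ((pderiv ^^ k) (P j)) z" for k z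
  proof (induction k arbitrary: z)
    case 0
    have "0 = exp (- poly (q j) z) * (\<Sum>i\<in>insert j I. poly (P i) z * exp (poly (q i) z))"
      using insert.prems(2) by simp
    also have "\<dots> = (\<Sum>i\<in>I. poly (P i) z * exp (poly (r i) z)) + poly (P j) z"
      using insert.hyps
      by (simp add: r_def distrib_left sum_distrib_left exp_diff exp_minus field_simps)
    finally show ?case by (simp add: eq_neg_iff_add_eq_0)
  next
    case (Suc k)
    have 1: "((\<lambda>z. \<Sum>i\<in>I. poly ((exp_deriv (r i) ^^ k) (P i)) z * exp (poly (r i) z)) has_field_derivative
        (\<Sum>i\<in>I. poly (exp_deriv (r i) ((exp_deriv (r i) ^^ k) (P i))) z * exp (poly (r i) z))) (at z)"
      by (intro DERIV_sum has_field_derivative_poly_mult_exp_poly)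
    have "((\<lambda>z. - poly ((pderiv ^^ k) (P j)) z) has_field_derivative
        - poly (pderiv ((pderiv ^^ k) (P j))) z) (at z)"
      by (intro DERIV_minus poly_DERIV)
    then show ?case using DERIV_unique[OF 1] by (simp add: Suc.IH)
  qed
  note * = this
  have zero: "P i = 0" if "i \<in> I" for i
  proof -
    define k where "k = Suc (degree (P j))"
    have "(exp_deriv (r i) ^^ k) (P i) = 0"
    proof (rule insert.IH[of r "\<lambda>i. (exp_deriv (r i) ^^ k) (P i)"])
      show "(\<Sum>i\<in>I. poly ((exp_deriv (r i) ^^ k) (P i)) z * exp (poly (r i) z)) = 0" for z
        using *[of k z] by (simp add: funpow_pderiv_eq_0 k_def del: funpow.simps)
    qed (use insert.prems(1) that in \<open>auto simp: r_def\<close>)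
    moreover have "degree (r i) \<noteq> 0"
      using insert.prems(1)[of i j] that insert.hyps by (auto simp: r_def)
    ultimately show ?thesis by (metis funpow_exp_deriv_eq_0D)
  qed
  moreover have "P j = 0"
  proof -
    have "poly (P j) z = 0" for z using *[of 0 z] zero by simp
    then show ?thesis by (simp flip: poly_all_0_iff_0)
  qed
  ultimately show ?case using insert.prems(3) by auto
qed simp

lemma exp_poly_independent_2:
  fixes A B p :: "complex poly"
  assumes "\<And>z. poly A z * exp (poly p z) + poly B z * exp (- poly p z) = 0" "degree p \<noteq> 0"
  shows "A = 0" "B = 0"
proof -
  define P where "P = (\<lambda>b. if b then A else B)"
  define q where "q = (\<lambda>b. if b then p else - p)"
  have "P i = 0" for i
  proof (rule exp_poly_independent[of UNIV q P])
    show "degree (q i - q j) \<noteq> 0" if "i \<noteq> j" for i j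
      using that assms(2) degree_double[of p] by (cases i; cases j) (auto simp: q_def simp del: mult_2)
    show "(\<Sum>i\<in>UNIV. poly (P i) z * exp (poly (q i) z)) = 0" for z
      using assms(1)[of z] by (simp add: P_def q_def UNIV_bool add.commute)
  qed auto
  from this[of True] this[of False] show "A = 0" "B = 0" by (simp_all add: P_def)
qed

text \<open>
  Only the coefficient of \<open>exp s\<close> is recorded.
\<close>
lemma exp_poly_independent_4:
  fixes A B C D p s :: "complex poly"
  assumes "\<And>z. poly A z * exp (poly p z) + poly B z * exp (- poly p z)
      + poly C z * exp (poly s z) + poly D z * exp (- poly s z) = 0"
    and "degree p \<noteq> 0" "degree s \<noteq> 0" "degree (p - s) \<noteq> 0" "degree (p + s) \<noteq> 0"
  shows "C = 0"
proof -
  define P where "P = (\<lambda>b. if fst b then (if snd b then A else B) else (if snd b then C else D))"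
  define q where "q = (\<lambda>b. if fst b then (if snd b then p else - p) else (if snd b then s else - s))"
  have UN: "(UNIV :: (bool \<times> bool) set) = {(True, True), (True, False), (False, True), (False, False)}"
    by auto
  have "- p - s = - (p + s)" "- p + s = - (p - s)" "s - p = - (p - s)" "- s - p = - (p + s)"
    by simp_all
  then have "degree (- p - s) \<noteq> 0" "degree (- p + s) \<noteq> 0" "degree (s - p) \<noteq> 0"
    "degree (- s - p) \<noteq> 0" "degree (s + p) \<noteq> 0" "degree (- s + p) \<noteq> 0"
    using assms(4,5) by (simp_all only: degree_minus add.commute[of s] uminus_add_conv_diff not_False_eq_True)
  then have "degree (q i - q j) \<noteq> 0" if "i \<noteq> j" for i j
    using that assms(2-) degree_double[of p] degree_double[of s]
    by (cases i; cases j) (auto simp: q_def)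
  moreover have "(\<Sum>i\<in>UNIV. poly (P i) z * exp (poly (q i) z)) = 0" for z
    using assms(1)[of z] by (simp add: UN P_def q_def algebra_simps)
  ultimately have "P (False, True) = 0"
    by (intro exp_poly_independent[of UNIV q P]) auto
  then show ?thesis by (simp add: P_def)
qed

section \<open>Leading coefficients under differentiation and translation\<close>

lemma higher_deriv_exp_poly_pair:
  "(deriv ^^ k) (\<lambda>z. (poly P z * exp (poly p z) + poly Q z * exp (poly q z)) / 2) =
    (\<lambda>z. (poly ((exp_deriv p ^^ k) P) z * exp (poly p z)
        + poly ((exp_deriv q ^^ k) Q) z * exp (poly q z)) / 2)"
proof (induction k)
  case (Suc k)
  have "deriv (\<lambda>z. (poly ((exp_deriv p ^^ k) P) z * exp (poly p z)
        + poly ((exp_deriv q ^^ k) Q) z * exp (poly q z)) / 2) z =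
      (poly ((exp_deriv p ^^ Suc k) P) z * exp (poly p z)
        + poly ((exp_deriv q ^^ Suc k) Q) z * exp (poly q z)) / 2" for z
    unfolding funpow.simps o_def
    by (intro DERIV_imp_deriv DERIV_cdivide DERIV_add has_field_derivative_poly_mult_exp_poly)
  then show ?case by (simp only: funpow.simps o_def Suc.IH)
qed simp

text \<open>
  The polynomial \<open>P(z + c)\<close>.
\<close>
abbreviation poly_shift :: "complex \<Rightarrow> complex poly \<Rightarrow> complex poly" where
  "poly_shift c P \<equiv> pcompose P [:c, 1:]"

lemma degree_poly_shift [simp]: "degree (poly_shift c P) = degree P"
  by (simp add: degree_pcompose)

lemma coeff_poly_shift:
  assumes "degree P \<le> Suc m"
  shows "coeff (poly_shift c P) (Suc m) = coeff P (Suc m)"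
    and "coeff (poly_shift c P) m = coeff P m + of_nat (Suc m) * c * coeff P (Suc m)"
proof -
  have "coeff (poly_shift c P) (Suc m) = coeff P (Suc m) \<and>
      coeff (poly_shift c P) m = coeff P m + of_nat (Suc m) * c * coeff P (Suc m)"
    using assms
  proof (induction m arbitrary: P)
    case 0
    obtain a P' where P: "P = pCons a P'" by (rule pCons_cases)
    with 0 have "degree P' = 0" by (cases "P' = 0") auto
    then obtain b where "P' = [:b:]" by (metis degree_eq_zeroE)
    then show ?case by (simp add: P pcompose_pCons)
  next
    case (Suc m)
    obtain a P' where P: "P = pCons a P'" by (rule pCons_cases)
    with Suc.prems have deg: "degree P' \<le> Suc m" by (cases "P' = 0") auto
    then have "coeff (poly_shift c P') (Suc (Suc m)) = 0" by (intro coeff_eq_0) simp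
    then show ?case using Suc.IH[OF deg] by (simp add: P pcompose_pCons algebra_simps)
  qed
  then show "coeff (poly_shift c P) (Suc m) = coeff P (Suc m)"
    "coeff (poly_shift c P) m = coeff P m + of_nat (Suc m) * c * coeff P (Suc m)" by auto
qed

lemma coeff_poly_shift_top:
  assumes "degree P \<le> n"
  shows "coeff (poly_shift c P) n = coeff P n"
proof (cases n)
  case 0
  with assms obtain b where "P = [:b:]" by (metis degree_eq_zeroE le_zero_eq)
  then show ?thesis by simp
next
  case (Suc m)
  then show ?thesis using assms coeff_poly_shift(1) by simp
qed

lemma exp_deriv_linear: "exp_deriv [:b, a:] P = pderiv P + smult a P"
  by (simp add: exp_deriv_def pderiv_pCons)

lemma degree_exp_deriv_linear_le: "degree ((exp_deriv [:b, a:] ^^ k) P) \<le> degree P"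
proof (induction k)
  case (Suc k)
  let ?X = "(exp_deriv [:b, a:] ^^ k) P"
  have "degree (pderiv ?X + smult a ?X) \<le> degree ?X"
    by (intro degree_add_le) (auto simp: degree_pderiv)
  then show ?case using Suc by (simp add: exp_deriv_linear[of b a ?X])
qed simp

lemma coeff_exp_deriv_linear_top:
  assumes "degree P \<le> n"
  shows "coeff ((exp_deriv [:b, a:] ^^ k) P) n = a ^ k * coeff P n"
proof (induction k)
  case (Suc k)
  have "coeff ((exp_deriv [:b, a:] ^^ k) P) (Suc n) = 0"
    using degree_exp_deriv_linear_le[where b = b and a = a and k = k and P = P] assms by (intro coeff_eq_0) simp
  then show ?case using Suc
    by (simp add: exp_deriv_linear[of b a "(exp_deriv [:b, a:] ^^ k) P"] coeff_pderiv)
qed simp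

text \<open>
  The factor \<open>a\<close> on the left avoids the exponent \<open>k - 1\<close>.
\<close>
lemma coeff_exp_deriv_linear_second:
  assumes "degree P \<le> Suc m"
  shows "a * coeff ((exp_deriv [:b, a:] ^^ (k::nat)) P) m
    = a ^ k * (a * coeff P m + of_nat k * (of_nat (Suc m) * coeff P (Suc m)))"
proof (induction k)
  case (Suc k)
  have "a * coeff ((exp_deriv [:b, a:] ^^ Suc k) P) m
      = a * (of_nat (Suc m) * (a ^ k * coeff P (Suc m)))
      + a * (a * coeff ((exp_deriv [:b, a:] ^^ k) P) m)"
    by (simp add: exp_deriv_linear[of b a "(exp_deriv [:b, a:] ^^ k) P"] coeff_pderiv coeff_exp_deriv_linear_top[OF assms] distrib_left)
  then show ?case unfolding Suc.IH by (simp add: algebra_simps)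
qed simp

text \<open>
  Pascal's rule for binomial sums. With the constant polynomial \<open>[:a:]\<close> for \<open>a\<close> and the derivatives of
  \<open>P\<close> for \<open>X\<close>, it expands the powers of \<open>pderiv + a\<close>.
\<close>
lemma binomial_sum_Suc:
  fixes a :: "'a :: comm_ring_1"
  shows "(\<Sum>l\<le>Suc k. of_nat (Suc k choose l) * a ^ (Suc k - l) * X l) =
    (\<Sum>l\<le>k. of_nat (k choose l) * a ^ (k - l) * X (Suc l)) +
    a * (\<Sum>l\<le>k. of_nat (k choose l) * a ^ (k - l) * X l)"
proof -
  have "a * (\<Sum>l\<le>k. of_nat (k choose l) * a ^ (k - l) * X l)
      = (\<Sum>l\<le>k. of_nat (k choose l) * a ^ (Suc k - l) * X l)"
    unfolding sum_distrib_left by (intro sum.cong) (auto simp: Suc_diff_le algebra_simps)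
  also have "\<dots> = (\<Sum>l\<le>Suc k. of_nat (k choose l) * a ^ (Suc k - l) * X l)"
    by (simp add: binomial_eq_0)
  also have "\<dots> = a ^ Suc k * X 0 + (\<Sum>l\<le>k. of_nat (k choose Suc l) * a ^ (k - l) * X (Suc l))"
    by (subst sum.atMost_Suc_shift) simp
  finally show ?thesis
    by (subst sum.atMost_Suc_shift) (simp add: sum.distrib algebra_simps)
qed

lemma funpow_exp_deriv_linear:
  "(exp_deriv [:b, a:] ^^ k) P = (\<Sum>l\<le>k. of_nat (k choose l) * [:a:] ^ (k - l) * (pderiv ^^ l) P)"
proof (induction k)
  case (Suc k)
  have "pderiv (of_nat n * [:a:] ^ j * X) = of_nat n * [:a:] ^ j * pderiv X" for n j X
  proof -
    have "of_nat n * [:a:] ^ j = [:of_nat n * a ^ j:]"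
      by (simp add: of_nat_poly poly_const_pow)
    then show ?thesis by (simp add: pderiv_smult)
  qed
  then have "pderiv ((exp_deriv [:b, a:] ^^ k) P)
      = (\<Sum>l\<le>k. of_nat (k choose l) * [:a:] ^ (k - l) * (pderiv ^^ Suc l) P)"
    unfolding Suc.IH by (simp add: higher_pderiv_sum[of 1, simplified])
  then show ?case unfolding binomial_sum_Suc Suc.IH[symmetric]
    by (simp add: exp_deriv_linear[of b a "(exp_deriv [:b, a:] ^^ k) P"])
qed simp

lemma poly_funpow_exp_deriv_linear:
  "poly ((exp_deriv [:b, a:] ^^ k) P) z = (\<Sum>l=0..k. of_nat (k choose l) * a ^ (k - l) * poly ((pderiv ^^ l) P) z)"
  by (simp add: funpow_exp_deriv_linear poly_sum atMost_atLeast0)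

section \<open>The equation for the coefficients\<close>

text \<open>
  The following lemmas draw the consequences of \<open>i R(z) (w A(z + c) - A(z)) = P(z)\<close>, where \<open>A\<close> is the
  coefficient of the \<open>k\<close>-th derivative of \<open>P(z) e\<^sup>a\<^sup>z\<^sup>+\<^sup>b\<close>. For \<open>w \<noteq> 1\<close> and \<open>a \<noteq> 0\<close> the
  polynomial \<open>w A(z + c) - A(z)\<close> has the degree of \<open>P\<close>.
\<close>
lemma shift_eq_leading:
  assumes eq: "smult \<i> (R * (smult w (poly_shift c A) - A)) = P"
    and A: "A = (exp_deriv [:b, a:] ^^ k) P" and nz: "P \<noteq> 0" "a \<noteq> 0" "w \<noteq> 1"
  obtains r where "R = [:r:]" "\<i> * r * (w - 1) * a ^ k = 1"
proof -
  define n where "n = degree P"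
  define \<Delta> where "\<Delta> = smult w (poly_shift c A) - A"
  have degA: "degree A \<le> n" unfolding A n_def by (rule degree_exp_deriv_linear_le)
  have cA: "coeff A n = a ^ k * coeff P n"
    unfolding A by (rule coeff_exp_deriv_linear_top) (simp add: n_def)
  have c\<Delta>: "coeff \<Delta> n = (w - 1) * (a ^ k * coeff P n)"
    by (simp add: \<Delta>_def coeff_poly_shift_top[OF degA] cA algebra_simps)
  have lead: "coeff P n \<noteq> 0" using nz(1) by (simp add: n_def)
  have "degree \<Delta> \<le> n" unfolding \<Delta>_def
    using degA by (intro degree_diff_le order_trans[OF degree_smult_le]) auto
  moreover have "n \<le> degree \<Delta>" using c\<Delta> lead nz by (intro le_degree) auto
  ultimately have deg\<Delta>: "degree \<Delta> = n" by simp
  have RP: "smult \<i> (R * \<Delta>) = P" using eq by (simp add: \<Delta>_def)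
  have "R \<noteq> 0" "\<Delta> \<noteq> 0" using RP nz(1) by auto
  then have "degree R + n = n" using RP deg\<Delta> by (auto simp: n_def degree_mult_eq)
  then obtain r where r: "R = [:r:]" by (metis add_cancel_left_left degree_eq_zeroE)
  have "\<i> * r * coeff \<Delta> n = coeff P n" using RP by (auto simp: r)
  then have "\<i> * r * (w - 1) * a ^ k * coeff P n = 1 * coeff P n"
    unfolding c\<Delta> by (simp add: mult.assoc)
  then show ?thesis using lead r that by simp
qed

text \<open>
  This compares the coefficients just below the leading ones; the relation between
  the leading coefficients makes the unknown coefficient \<open>p0\<close> of \<open>P\<close> cancel.
\<close>
lemma shift_eq_second:
  assumes eq: "smult \<i> (R * (smult w (poly_shift c A) - A)) = P"
    and A: "A = (exp_deriv [:b, a:] ^^ k) P" and nz: "P \<noteq> 0" "a \<noteq> 0" "w \<noteq> 1"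
    and deg: "degree P \<noteq> 0"
  shows "(w - 1) * of_nat k + w * c * a = 0"
proof -
  obtain r where r: "R = [:r:]" and one: "\<i> * r * (w - 1) * a ^ k = 1"
    using shift_eq_leading[OF eq A nz] .
  obtain m where m: "degree P = Suc m" using deg by (cases "degree P") auto
  have degA: "degree A \<le> Suc m" unfolding A m[symmetric] by (rule degree_exp_deriv_linear_le)
  define p1 p0 where "p1 = coeff P (Suc m)" and "p0 = coeff P m"
  have "p1 \<noteq> 0" using nz(1) m by (metis leading_coeff_neq_0 p1_def)
  have A1: "coeff A (Suc m) = a ^ k * p1"
    unfolding A p1_def by (rule coeff_exp_deriv_linear_top) (simp add: m)
  have A0: "a * coeff A m = a ^ k * (a * p0 + of_nat k * (of_nat (Suc m) * p1))"
    unfolding A p1_def p0_def by (rule coeff_exp_deriv_linear_second) (simp add: m)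
  have sh: "coeff (poly_shift c A) m = coeff A m + of_nat (Suc m) * c * (a ^ k * p1)"
    using coeff_poly_shift(2)[OF degA] by (simp add: A1)
  have "p0 = \<i> * r * (w * coeff (poly_shift c A) m - coeff A m)"
    unfolding p0_def by (subst eq[symmetric]) (simp add: r algebra_simps)
  then have "a * p0 = a * (\<i> * r * (w * coeff (poly_shift c A) m - coeff A m))"
    by (rule arg_cong)
  also have "\<dots> = \<i> * r * ((w - 1) * (a * coeff A m) + a * w * (of_nat (Suc m) * c * (a ^ k * p1)))"
    unfolding sh by (simp add: algebra_simps)
  also have "\<dots> = (\<i> * r * (w - 1) * a ^ k) * (a * p0)
      + \<i> * r * a ^ k * of_nat (Suc m) * p1 * ((w - 1) * of_nat k + w * c * a)"
    unfolding A0 by (simp add: algebra_simps del: of_nat_Suc)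
  finally have "\<i> * r * a ^ k * of_nat (Suc m) * p1 * ((w - 1) * of_nat k + w * c * a) = 0"
    unfolding one by simp
  moreover have "r \<noteq> 0" using one by auto
  ultimately show ?thesis using nz(2) \<open>p1 \<noteq> 0\<close> by (simp del: of_nat_Suc)
qed

text \<open>
  For \<open>w = 1\<close> the difference \<open>A(z + c) - A(z)\<close> has degree exactly one less than \<open>P\<close>.
\<close>
lemma shift_eq_degree:
  assumes eq: "smult \<i> (R * (poly_shift c A - A)) = P"
    and A: "A = (exp_deriv [:b, a:] ^^ k) P" and nz: "P \<noteq> 0" "a \<noteq> 0" "c \<noteq> 0"
  shows "degree R = 1" "degree P \<noteq> 0"
proof -
  define \<Delta> where "\<Delta> = poly_shift c A - A"
  have RP: "smult \<i> (R * \<Delta>) = P" using eq by (simp add: \<Delta>_def)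
  then have "R \<noteq> 0" "\<Delta> \<noteq> 0" using nz(1) by auto
  have degA: "degree A \<le> degree P" unfolding A by (rule degree_exp_deriv_linear_le)
  show deg: "degree P \<noteq> 0"
  proof
    assume "degree P = 0"
    with degA obtain x where "A = [:x:]" by (metis degree_eq_zeroE le_zero_eq)
    then show False using \<open>\<Delta> \<noteq> 0\<close> by (simp add: \<Delta>_def)
  qed
  obtain m where m: "degree P = Suc m" using deg by (cases "degree P") auto
  have "coeff P (Suc m) \<noteq> 0" using nz(1) m by (metis leading_coeff_neq_0)
  moreover have "coeff A (Suc m) = a ^ k * coeff P (Suc m)"
    unfolding A by (rule coeff_exp_deriv_linear_top) (simp add: m)
  ultimately have "coeff A (Suc m) \<noteq> 0" using nz(2) by simp
  moreover have "coeff \<Delta> m = of_nat (Suc m) * c * coeff A (Suc m)"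
    "coeff \<Delta> (Suc m) = 0"
    using coeff_poly_shift[of A m c] degA m by (simp_all add: \<Delta>_def)
  ultimately have "coeff \<Delta> m \<noteq> 0" "coeff \<Delta> (Suc m) = 0" using nz(3) by (simp_all del: of_nat_Suc)
  moreover have "degree \<Delta> \<le> Suc m"
    unfolding \<Delta>_def using degA m by (intro degree_diff_le) auto
  ultimately have "degree \<Delta> = m"
    by (metis \<open>\<Delta> \<noteq> 0\<close> le_SucE le_antisym le_degree leading_coeff_neq_0)
  moreover have "degree P = degree R + degree \<Delta>"
    using \<open>R \<noteq> 0\<close> \<open>\<Delta> \<noteq> 0\<close> by (simp flip: RP add: degree_mult_eq)
  ultimately show "degree R = 1" using m by simp
qed

lemma eq_quotient_of_mult:
  assumes "smult \<i> (R * D) = P" "P \<noteq> 0" "\<And>z. d z = \<i> * poly D z"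
  shows "eq_quotient R P d"
proof -
  have "D \<noteq> 0" using assms(1,2) by auto
  then obtain z where "poly D z \<noteq> 0" using poly_all_0_iff_0 by blast
  moreover have "poly R z = poly P z / d z" if "d z \<noteq> 0" for z
    using that by (simp flip: assms(1) add: assms(3) field_simps)
  ultimately show ?thesis unfolding eq_quotient_def by (auto simp: assms(3))
qed

text \<open>
  Either equation makes \<open>x\<close> real, and then \<open>exp x > 0\<close>.
\<close>
lemma exp_real_shift_contradiction:
  assumes "exp x = -1" and "-2 * of_nat k - x = 0 \<or> - 2 * of_nat k + x = (0::complex)"
  shows False
proof -
  obtain t :: real where "x = of_real t"
    using assms(2) by (elim disjE)
      (metis add_0 diff_add_cancel of_real_minus of_real_mult of_real_numeral of_real_of_nat_eq,
       metis add_eq_0_iff minus_mult_left minus_minus of_real_mult of_real_numeral of_real_of_nat_eq)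
  then have "of_real (exp t) = (of_real (-1) :: complex)"
    using assms(1) by (simp add: exp_of_real)
  then have "exp t = -1" by (simp only: of_real_eq_iff)
  then show False using exp_gt_zero[of t] by linarith
qed

section \<open>The form of the solution\<close>

text \<open>
  For \<open>deg p \<ge> 2\<close> the polynomials \<open>\<plusminus>p(z)\<close>, \<open>\<plusminus>p(z + c)\<close> differ pairwise by nonconstant polynomials.
\<close>
lemma degree_poly_shift_pm:
  assumes "degree p \<ge> 2" "c \<noteq> 0"
  shows "degree (p - poly_shift c p) \<noteq> 0" "degree (p + poly_shift c p) \<noteq> 0"
proof -
  obtain m where m: "degree p = Suc m" using assms(1) by (cases "degree p") auto
  then have lead: "coeff p (Suc m) \<noteq> 0" by (metis leading_coeff_neq_0 degree_0 nat.distinct(1))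
  have "coeff (p - poly_shift c p) m \<noteq> 0"
    using coeff_poly_shift(2)[of p m c] m lead assms(2) by (simp del: of_nat_Suc)
  then have "m \<le> degree (p - poly_shift c p)" by (rule le_degree)
  then show "degree (p - poly_shift c p) \<noteq> 0" using assms(1) m by simp
  have "coeff (p + poly_shift c p) (Suc m) \<noteq> 0"
    using coeff_poly_shift(1)[of p m c] m lead by (simp flip: mult_2)
  then have "Suc m \<le> degree (p + poly_shift c p)" by (rule le_degree)
  then show "degree (p + poly_shift c p) \<noteq> 0" by simp
qed

lemma solution_form:
  fixes k :: nat and c :: complex and R Q :: "complex poly" and f :: "complex \<Rightarrow> complex"
  assumes "Q \<noteq> 0" and hol: "f holomorphic_on UNIV" and "finite_order f"
    and eq: "\<And>z. (f z)\<^sup>2 + (poly R z)\<^sup>2 * ((deriv ^^ k) f (z + c) - (deriv ^^ k) f z)\<^sup>2 = poly Q z"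
  obtains Q1 Q2 p where "Q1 * Q2 = Q"
    "\<And>z. f z + \<i> * (poly R z * ((deriv ^^ k) f (z + c) - (deriv ^^ k) f z)) = poly Q1 z * exp (poly p z)"
    "\<And>z. f z - \<i> * (poly R z * ((deriv ^^ k) f (z + c) - (deriv ^^ k) f z)) = poly Q2 z * exp (- poly p z)"
proof -
  define g where "g = (\<lambda>z. poly R z * ((deriv ^^ k) f (z + c) - (deriv ^^ k) f z))"
  define F where "F = (\<lambda>z. f z + \<i> * g z)"
  define G where "G = (\<lambda>z. f z - \<i> * g z)"
  have holk: "(deriv ^^ k) f holomorphic_on UNIV"
    by (intro holomorphic_higher_deriv hol) auto
  have "(\<lambda>z. (deriv ^^ k) f (z + c)) holomorphic_on UNIV"
  proof -
    have "(\<lambda>z. z + c) holomorphic_on UNIV" by (intro holomorphic_intros)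
    from holomorphic_on_compose_gen[OF this holk] show ?thesis by (simp add: o_def)
  qed
  then have holg: "g holomorphic_on UNIV"
    unfolding g_def by (intro holomorphic_on_mult holomorphic_on_diff holk holomorphic_intros)
  have holF: "F holomorphic_on UNIV" "G holomorphic_on UNIV"
    unfolding F_def G_def by (intro holomorphic_intros hol holg)+
  have bf: "poly_exp_bounded f" by (rule finite_order_imp_poly_exp_bounded) fact+
  then have bk: "poly_exp_bounded ((deriv ^^ k) f)" by (rule poly_exp_bounded_higher_deriv) fact
  have "poly_exp_bounded (\<lambda>z. f z + \<i> * (poly R z * ((deriv ^^ k) f (z + c) + (-1) * (deriv ^^ k) f z)))"
    by (intro poly_exp_bounded_add poly_exp_bounded_mult poly_exp_bounded_const bf bk
        poly_exp_bounded_poly poly_exp_bounded_shift)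
  then have bF: "poly_exp_bounded F" by (simp add: F_def g_def)
  have "F z * G z = poly Q z" for z
  proof -
    have "F z * G z = (f z)\<^sup>2 + (g z)\<^sup>2"
      by (simp add: F_def G_def algebra_simps power2_eq_square)
    then show ?thesis using eq[of z] by (simp add: g_def power_mult_distrib)
  qed
  then obtain Q1 Q2 E1 E2 where *: "Q1 * Q2 = Q" "E1 holomorphic_on UNIV" "poly_exp_bounded E1"
    "\<And>z. F z = poly Q1 z * E1 z" "\<And>z. G z = poly Q2 z * E2 z" "\<And>z. E1 z * E2 z = 1"
    using entire_factors_of_poly[OF holF bF \<open>Q \<noteq> 0\<close>] by blast
  have "E1 z \<noteq> 0" for z using *(6)[of z] by auto
  then obtain p where p: "\<And>z. E1 z = exp (poly p z)"
    using zero_free_poly_exp_bounded[OF *(2,3)] by blast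
  have "E2 z = exp (- poly p z)" for z
    using *(6)[of z] by (simp add: p exp_minus field_simps)
  then show ?thesis using that[of Q1 Q2 p] *(1,4,5) p by (simp add: F_def G_def g_def)
qed

theorem theorem2p1:
  fixes k :: nat and c :: complex and R Q :: "complex poly" and f :: "complex \<Rightarrow> complex"
  assumes "k \<ge> 1" and "c \<noteq> 0" and "R \<noteq> 0" and "Q \<noteq> 0"
    and "transcendental_entire f" and "finite_order f"
    and "\<And>z. (f z)\<^sup>2 + (poly R z)\<^sup>2 * ((deriv ^^ k) f (z + c) - (deriv ^^ k) f z)\<^sup>2 = poly Q z"
  shows "\<exists>(a::complex) (b::complex) (Q1::complex poly) (Q2::complex poly).
      (\<forall>z. f z = (poly Q1 z * exp (a * z + b) + poly Q2 z * exp (- (a * z + b))) / 2)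
    \<and> Q1 * Q2 = Q
    \<and> (exp (a * c) \<noteq> 1 \<longrightarrow>
         odd k \<and> (\<exists>q. Q = [:q:]) \<and> (\<exists>r. R = [:r:] \<and> 2 * \<i> * r * a ^ k + 1 = 0))
    \<and> (exp (a * c) = 1 \<longrightarrow>
         degree R = 1 \<and> degree Q1 \<noteq> 0 \<and> degree Q2 \<noteq> 0
       \<and> eq_quotient R Q1 (\<lambda>z. \<i> * (\<Sum>l=0..k. of_nat (k choose l) * a ^ (k - l)
            * (poly ((pderiv ^^ l) Q1) (z + c) - poly ((pderiv ^^ l) Q1) z)))
       \<and> eq_quotient R Q2 (\<lambda>z. \<i> * (\<Sum>l=0..k. of_nat (k choose l) * (-1) ^ (k - l + 1) * a ^ (k - l)
            * (poly ((pderiv ^^ l) Q2) (z + c) - poly ((pderiv ^^ l) Q2) z))))"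
proof -
  note c = assms(2) and R = assms(3) and Q = assms(4)
  have hol: "f holomorphic_on UNIV" and transc: "\<not> (\<exists>p :: complex poly. \<forall>z. f z = poly p z)"
    using assms(5) by (auto simp: transcendental_entire_def)
  define g where "g = (\<lambda>z. poly R z * ((deriv ^^ k) f (z + c) - (deriv ^^ k) f z))"
  obtain Q1 Q2 p where Q12: "Q1 * Q2 = Q"
    and F: "\<And>z. f z + \<i> * g z = poly Q1 z * exp (poly p z)"
    and G: "\<And>z. f z - \<i> * g z = poly Q2 z * exp (- poly p z)"
    unfolding g_def using solution_form[OF Q hol assms(6,7)] by blast
  have nz: "Q1 \<noteq> 0" "Q2 \<noteq> 0" using Q12 Q by auto
  have f: "f z = (poly Q1 z * exp (poly p z) + poly Q2 z * exp (- poly p z)) / 2" for z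
    by (simp flip: F G)
  have g: "2 * \<i> * g z = poly Q1 z * exp (poly p z) - poly Q2 z * exp (- poly p z)" for z
    by (simp flip: F G)
  define A where "A = (exp_deriv p ^^ k) Q1"
  define B where "B = (exp_deriv (- p) ^^ k) Q2"
  have "(deriv ^^ k) f = (\<lambda>z. (poly A z * exp (poly p z) + poly B z * exp (- poly p z)) / 2)"
  proof -
    have "f = (\<lambda>z. (poly Q1 z * exp (poly p z) + poly Q2 z * exp (poly (- p) z)) / 2)"
      by (rule ext) (simp add: f)
    then show ?thesis
      using higher_deriv_exp_poly_pair[of k Q1 p Q2 "- p"] by (simp add: A_def B_def)
  qed
  then have "2 * \<i> * g z = \<i> * poly R z * (poly A (z + c) * exp (poly p (z + c)) + poly B (z + c) * exp (- poly p (z + c))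
      - poly A z * exp (poly p z) - poly B z * exp (- poly p z))" for z
    by (simp add: g_def field_simps)
  then have key: "\<i> * poly R z * (poly A (z + c) * exp (poly p (z + c)) + poly B (z + c) * exp (- poly p (z + c))
      - poly A z * exp (poly p z) - poly B z * exp (- poly p z))
      = poly Q1 z * exp (poly p z) - poly Q2 z * exp (- poly p z)" for z
    using g[of z] by metis
  have shift: "poly (poly_shift c P) z = poly P (z + c)" for P z
    by (simp add: poly_pcompose add.commute)
  have "degree p \<noteq> 0"
  proof
    assume "degree p = 0"
    then obtain b where "p = [:b:]" by (metis degree_eq_zeroE)
    then have "f z = poly (smult (1 / 2) (smult (exp b) Q1 + smult (exp (- b)) Q2)) z" for z
      by (simp add: f mult.commute)
    then show False using transc by blast
  qed
  moreover have "\<not> degree p \<ge> 2"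
  proof
    assume deg: "degree p \<ge> 2"
    have "smult \<i> (R * poly_shift c A) = 0"
    proof (rule exp_poly_independent_4[where s = "poly_shift c p" and p = p])
      show "poly (- smult \<i> (R * A) - Q1) z * exp (poly p z)
          + poly (- smult \<i> (R * B) + Q2) z * exp (- poly p z)
          + poly (smult \<i> (R * poly_shift c A)) z * exp (poly (poly_shift c p) z)
          + poly (smult \<i> (R * poly_shift c B)) z * exp (- poly (poly_shift c p) z) = 0" for z
        using key[of z] by (simp add: shift algebra_simps)
    qed (use deg degree_poly_shift_pm[OF deg c] in auto)
    then have "poly_shift c A = 0" using R by simp
    then have "A = 0" by (simp add: pcompose_eq_0_iff)
    then show False using nz(1) funpow_exp_deriv_eq_0D \<open>degree p \<noteq> 0\<close> by (metis A_def)
  qed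
  ultimately have "degree p = 1" by simp
  then obtain a b where p: "p = [:b, a:]" and a: "a \<noteq> 0"
    by (metis degree1_coeffs)
  define w where "w = exp (a * c)"
  define v where "v = exp (- (a * c))"
  have wv: "w * v = 1" by (simp add: w_def v_def flip: exp_add)
  have exps: "exp (poly p (z + c)) = w * exp (poly p z)" "exp (- poly p (z + c)) = v * exp (- poly p z)" for z
    by (simp_all add: p w_def v_def algebra_simps flip: exp_add)
  (* Since exp (p (z + c)) is a constant multiple of exp (p z), only two exponentials remain. *)
  have "poly (smult \<i> (R * (smult w (poly_shift c A) - A)) - Q1) z * exp (poly p z)
      + poly (smult \<i> (R * (smult v (poly_shift c B) - B)) + Q2) z * exp (- poly p z) = 0" for z
    using key[of z] unfolding exps by (simp add: shift algebra_simps)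
  from exp_poly_independent_2[OF this \<open>degree p \<noteq> 0\<close>]
  have e1: "smult \<i> (R * (smult w (poly_shift c A) - A)) = Q1"
    and e2: "smult \<i> (- R * (smult v (poly_shift c B) - B)) = Q2"
    by (simp_all add: eq_neg_iff_add_eq_0[symmetric])
  have A: "A = (exp_deriv [:b, a:] ^^ k) Q1" and B: "B = (exp_deriv [:- b, - a:] ^^ k) Q2"
    by (simp_all add: A_def B_def p)
  have "- a \<noteq> 0" using a by simp
  have "odd k \<and> (\<exists>q. Q = [:q:]) \<and> (\<exists>r. R = [:r:] \<and> 2 * \<i> * r * a ^ k + 1 = 0)" if w1: "w \<noteq> 1"
  proof -
    have "v \<noteq> 1" using wv w1 by auto
    obtain r where r: "R = [:r:]" "\<i> * r * (w - 1) * a ^ k = 1"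
      using shift_eq_leading[OF e1 A nz(1) a w1] .
    obtain r' where r': "- R = [:r':]" "\<i> * r' * (v - 1) * (- a) ^ k = 1"
      using shift_eq_leading[OF e2 B nz(2) \<open>- a \<noteq> 0\<close> \<open>v \<noteq> 1\<close>] .
    have "r' = - r" using r(1) r'(1) by simp
    have "r \<noteq> 0" using r(2) by auto
    (* The two leading coefficient relations share the factor i r a ^ k. *)
    have "\<i> * r * a ^ k * (w - 1) = \<i> * r * a ^ k * ((1 - v) * (-1) ^ k)"
      using r(2) r'(2) unfolding \<open>r' = - r\<close> power_minus[of a] by (simp add: algebra_simps)
    then have "w - 1 = (1 - v) * (-1) ^ k" using \<open>r \<noteq> 0\<close> a by simp
    then have "w * (w - 1) = w * ((1 - v) * (-1) ^ k)" by (rule arg_cong)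
    also have "\<dots> = (w - w * v) * (-1) ^ k" by (simp add: algebra_simps)
    finally have "(w - 1) * w = (w - 1) * (-1) ^ k" unfolding wv by (simp only: mult.commute)
    then have "w = (-1) ^ k" using w1 by simp
    then have "odd k" using w1 by (cases "even k") auto
    with \<open>w = (-1) ^ k\<close> have w: "w = -1" by simp
    have v: "v = -1" using wv unfolding w by (metis minus_mult_minus mult_1 mult_minus_left)
    have expac: "exp (a * c) = -1" using w by (simp add: w_def)
    have "degree Q1 = 0"
    proof (rule ccontr)
      assume "degree Q1 \<noteq> 0"
      from shift_eq_second[OF e1 A nz(1) a w1 this]
      have "(w - 1) * of_nat k + w * c * a = 0" .
      moreover have "- 2 * of_nat k - a * c = (w - 1) * of_nat k + w * c * a"
        unfolding w by (simp add: algebra_simps)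
      ultimately have "- 2 * of_nat k - a * c = 0" by (rule trans[rotated])
      then show False using exp_real_shift_contradiction[OF expac] by blast
    qed
    moreover have "degree Q2 = 0"
    proof (rule ccontr)
      assume "degree Q2 \<noteq> 0"
      from shift_eq_second[OF e2 B nz(2) \<open>- a \<noteq> 0\<close> \<open>v \<noteq> 1\<close> this]
      have "(v - 1) * of_nat k + v * c * - a = 0" .
      moreover have "- 2 * of_nat k + a * c = (v - 1) * of_nat k + v * c * - a"
        unfolding v by (simp add: algebra_simps)
      ultimately have "- 2 * of_nat k + a * c = 0" by (rule trans[rotated])
      then show False using exp_real_shift_contradiction[OF expac] by blast
    qed
    ultimately have "degree Q = 0" using nz by (simp add: degree_mult_eq flip: Q12)
    then have "\<exists>q. Q = [:q:]" by (metis degree_eq_zeroE)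
    moreover have "2 * \<i> * r * a ^ k + 1 = 1 - \<i> * r * (w - 1) * a ^ k"
      unfolding w by (simp add: algebra_simps)
    then have "2 * \<i> * r * a ^ k + 1 = 0" unfolding r(2) by simp
    ultimately show ?thesis using \<open>odd k\<close> r(1) by blast
  qed
  moreover have "degree R = 1 \<and> degree Q1 \<noteq> 0 \<and> degree Q2 \<noteq> 0
       \<and> eq_quotient R Q1 (\<lambda>z. \<i> * (\<Sum>l=0..k. of_nat (k choose l) * a ^ (k - l)
            * (poly ((pderiv ^^ l) Q1) (z + c) - poly ((pderiv ^^ l) Q1) z)))
       \<and> eq_quotient R Q2 (\<lambda>z. \<i> * (\<Sum>l=0..k. of_nat (k choose l) * (-1) ^ (k - l + 1) * a ^ (k - l)
            * (poly ((pderiv ^^ l) Q2) (z + c) - poly ((pderiv ^^ l) Q2) z)))" if "w = 1"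
  proof (intro conjI)
    have "v = 1" using wv that by simp
    have e1': "smult \<i> (R * (poly_shift c A - A)) = Q1" using e1 that by simp
    have e2': "smult \<i> (- R * (poly_shift c B - B)) = Q2" using e2 \<open>v = 1\<close> by simp
    show "degree R = 1" "degree Q1 \<noteq> 0"
      using shift_eq_degree[OF e1' A nz(1) a c] by auto
    show "degree Q2 \<noteq> 0"
      using shift_eq_degree[OF e2' B nz(2) \<open>- a \<noteq> 0\<close> c] by auto
    show "eq_quotient R Q1 (\<lambda>z. \<i> * (\<Sum>l=0..k. of_nat (k choose l) * a ^ (k - l)
            * (poly ((pderiv ^^ l) Q1) (z + c) - poly ((pderiv ^^ l) Q1) z)))"
    proof (rule eq_quotient_of_mult[OF e1' nz(1)])
      show "\<i> * (\<Sum>l=0..k. of_nat (k choose l) * a ^ (k - l)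
            * (poly ((pderiv ^^ l) Q1) (z + c) - poly ((pderiv ^^ l) Q1) z))
          = \<i> * poly (poly_shift c A - A) z" for z
        unfolding poly_diff shift A poly_funpow_exp_deriv_linear
        by (simp add: right_diff_distrib sum_subtractf)
    qed
    have e2'': "smult \<i> (R * (B - poly_shift c B)) = Q2"
      using e2' by (simp add: algebra_simps)
    show "eq_quotient R Q2 (\<lambda>z. \<i> * (\<Sum>l=0..k. of_nat (k choose l) * (-1) ^ (k - l + 1) * a ^ (k - l)
            * (poly ((pderiv ^^ l) Q2) (z + c) - poly ((pderiv ^^ l) Q2) z)))"
    proof (rule eq_quotient_of_mult[OF e2'' nz(2)])
      show "\<i> * (\<Sum>l=0..k. of_nat (k choose l) * (-1) ^ (k - l + 1) * a ^ (k - l)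
            * (poly ((pderiv ^^ l) Q2) (z + c) - poly ((pderiv ^^ l) Q2) z))
          = \<i> * poly (B - poly_shift c B) z" for z
        unfolding poly_diff shift B poly_funpow_exp_deriv_linear power_minus[of a]
        by (simp add: sum_subtractf[symmetric]) (intro sum.cong refl, simp add: algebra_simps)
    qed
  qed
  ultimately show ?thesis
    using f Q12 unfolding w_def
    by (intro exI[of _ a] exI[of _ b] exI[of _ Q1] exI[of _ Q2]) (simp add: p algebra_simps)
qed

end
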